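(* Let $r$ and $t$ be positive integers, let $$H_{r,t}(q):=\frac{1}{(q^t;q^t)_\infty^r}=\sum_{n=0}^\infty c_{r,t}(n)q^n,$$ and define a sequence of integers by $C_{r,t}(n)=c_{r,t}(tn)$. Then the following statements hold. (1) For each fixed $d\ge1$, the Jensen polynomial $J_{C_{r,t}}^{d,n}(X)$ is hyperbolic for all but finitely many $n$. Moreover, up to normalization, the Jensen polynomials $J_{C_{r,t}}^{d,n}(X)$ converge to the Hermite polynomial $H_d(X)$ uniformly over compact subsets of $\mathbb{R}$ as $n\to\infty$; that is, for each fixed $d\geq 1$ there are sequences of positive real numbers $\{A(n)\}$ and $\{\delta(n)\}$ with $\delta(n)\to0$ such that $$\frac{\delta(n)^{-d}}{C_{r,t}(n)}\,J_{C_{r,t}}^{d,n}\left(\frac{\delta(n)X-1}{\exp(A(n))}\right)\longrightarrow H_d(X)\qquad (n\to\infty)$$ uniformly in $X$ on every compact subset of $\mathbb{R}$. (2) The sequence $C_{r,t}(n)$ asymptotically satisfies all higher order Turán inequalities; that is, for every $d\ge1$, for all sufficiently large $n$, the sequence $C_{r,t}$ satisfies the Turán inequalities of order $d$ at $n$.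
   Context: $(a;q)_\infty:=\prod_{n\ge0}(1-aq^n)$ is the $q$-Pochhammer symbol. For a sequence of real numbers $\{\alpha(n)\}$, the Jensen polynomial of degree $d$ and shift $n$ is $J_\alpha^{d,n}(X)=\sum_{j=0}^d\binom{d}{j}\alpha(n+j)X^j$. A polynomial is hyperbolic if every zero of it is a real number. The Hermite polynomials $H_d(X)$ are normalized by the generating function $e^{-t^2+Xt}=\sum_{d=0}^\infty H_d(X)\frac{t^d}{d!}$ (here $t$ is a formal variable). Turán inequalities of order $d$ at $n$: the polynomial $J_\alpha^{d,n}(X)$ has degree exactly $d$ and, if $\beta_1,\dots,\beta_d$ are its complex roots listed with multiplicity and $S_0=d$, $S_k=\beta_1^k+\dots+\beta_d^k$ for $k\ge1$, then the Hankel determinants satisfy $$\Delta_k^{(d)}=\det\left(S_{i+j}\right)_{0\le i,j\le k-1}\ge0\qquad\text{for all }1\le k\le d.$$ *)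

theory Defs
  imports
    "HOL-Analysis.Analysis"
    "HOL-Computational_Algebra.Computational_Algebra"
    "HOL-Library.Nonpos_Ints"
    "Jordan_Normal_Form.Determinant"
begin

text \<open>
  The q-Pochhammer symbol is polymorphic: it can be read analytically (\<open>'a = complex\<close>) or
  formally (\<open>'a = real fps\<close>, with the product converging coefficientwise).
  The generating function below uses the formal reading.
\<close>

definition qpochhammer_inf :: "'a \<Rightarrow> 'a \<Rightarrow> 'a :: {t2_space, comm_ring_1}" where
  "qpochhammer_inf a q = (\<Prod>n. 1 - a * q ^ n)"

definition H_gf :: "nat \<Rightarrow> nat \<Rightarrow> real fps" where
  "H_gf r t = 1 / qpochhammer_inf (fps_X ^ t) (fps_X ^ t) ^ r"

definition c_coeff :: "nat \<Rightarrow> nat \<Rightarrow> nat \<Rightarrow> real" where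
  "c_coeff r t n = fps_nth (H_gf r t) n"

definition C_seq :: "nat \<Rightarrow> nat \<Rightarrow> nat \<Rightarrow> real" where
  "C_seq r t n = c_coeff r t (t * n)"

definition jensen_poly :: "(nat \<Rightarrow> real) \<Rightarrow> nat \<Rightarrow> nat \<Rightarrow> real poly" where
  "jensen_poly \<alpha> d n = (\<Sum>j\<le>d. monom (of_nat (d choose j) * \<alpha> (n + j)) j)"

definition hyperbolic :: "real poly \<Rightarrow> bool" where
  "hyperbolic p \<longleftrightarrow> (\<forall>z :: complex. poly (map_poly complex_of_real p) z = 0 \<longrightarrow> z \<in> \<real>)"

text \<open>
  The value at \<open>x\<close> of the Hermite polynomial in the normalization given by the generating function
  \<open>exp (- t\<^sup>2 + x t) = (\<Sum>d. H\<^sub>d(x) t\<^sup>d / d!)\<close>; \<open>fps_X\<close> plays the role of \<open>t\<close>.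
  (These are not the physicists' polynomials: \<open>H\<^sub>1(x) = x\<close> and \<open>H\<^sub>2(x) = x\<^sup>2 - 2\<close>.)
\<close>

definition hermite :: "nat \<Rightarrow> real \<Rightarrow> real" where
  "hermite d x = fact d * fps_nth (fps_compose (fps_exp 1) (- (fps_X ^ 2) + fps_const x * fps_X)) d"

lemma hermite_gf:
  "Abs_fps (\<lambda>d. hermite d x / fact d) = fps_compose (fps_exp 1) (- (fps_X ^ 2) + fps_const x * fps_X)"
  by (rule fps_ext)
    (simp only: fps_nth_Abs_fps hermite_def nonzero_mult_div_cancel_left fact_nonzero not_False_eq_True)

definition root_power_sum :: "real poly \<Rightarrow> nat \<Rightarrow> complex" where
  "root_power_sum p k = (\<Sum>\<beta>\<in>#proots (map_poly complex_of_real p). \<beta> ^ k)"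

definition hankel_det :: "real poly \<Rightarrow> nat \<Rightarrow> complex" where
  "hankel_det p k = Determinant.det (Matrix.mat k k (\<lambda>(i, j). root_power_sum p (i + j)))"

text \<open>
  The power sums of the complex roots, hence the determinants, are formally complex numbers.
  Membership in \<open>\<real>\<^sub>\<ge>\<^sub>0\<close> says that a determinant is a nonnegative real.
\<close>

definition turan_inequalities :: "(nat \<Rightarrow> real) \<Rightarrow> nat \<Rightarrow> nat \<Rightarrow> bool" where
  "turan_inequalities \<alpha> d n \<longleftrightarrow>
     degree (jensen_poly \<alpha> d n) = d \<and>
     (\<forall>k\<in>{1..d}. hankel_det (jensen_poly \<alpha> d n) k \<in> \<real>\<^sub>\<ge>\<^sub>0)"

text \<open>
  Since \<open>prodinf\<close> and division are total, the following facts record that the product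
  converges, that the denominator is invertible, and that the coefficients are integers.
\<close>

lemma partial_prod_nth_stable:
  assumes "t > 0" "m \<le> n"
  shows "fps_nth (\<Prod>i\<le>n. 1 - fps_X ^ t * (fps_X ^ t) ^ i :: real fps) m =
         fps_nth (\<Prod>i\<le>m. 1 - fps_X ^ t * (fps_X ^ t) ^ i) m"
  using assms(2)
proof (induction n rule: dec_induct)
  case (step n)
  define P :: "real fps" where "P = (\<Prod>i\<le>n. 1 - fps_X ^ t * (fps_X ^ t) ^ i)"
  have "m < t * Suc (Suc n)"
  proof -
    have "m < 1 * Suc (Suc n)" using step by simp
    also have "\<dots> \<le> t * Suc (Suc n)" using assms(1) by (intro mult_right_mono) auto
    finally show ?thesis .
  qed
  have "fps_X ^ t * (fps_X ^ t) ^ Suc n = (fps_X ^ (t * Suc (Suc n)) :: real fps)"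
    by (simp add: power_add power_mult)
  hence "(\<Prod>i\<le>Suc n. 1 - fps_X ^ t * (fps_X ^ t) ^ i) = P - fps_X ^ (t * Suc (Suc n)) * P"
    unfolding prod.atMost_Suc P_def[symmetric] by (simp only: right_diff_distrib mult_1_right mult_1_left mult.commute)
  moreover have "fps_nth (fps_X ^ (t * Suc (Suc n)) * P) m = 0"
    using \<open>m < t * Suc (Suc n)\<close> by (simp only: fps_X_power_mult_nth if_True)
  ultimately have "fps_nth (\<Prod>i\<le>Suc n. 1 - fps_X ^ t * (fps_X ^ t) ^ i) m = fps_nth P m"
    by (simp only: fps_sub_nth diff_zero)
  thus ?case using step.IH by (simp only: P_def)
qed (rule refl)

lemma has_prod_qpochhammer_fps:
  assumes "t > 0"
  shows "(\<lambda>n. 1 - fps_X ^ t * (fps_X ^ t) ^ n :: real fps) has_prod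
           Abs_fps (\<lambda>m. fps_nth (\<Prod>i\<le>m. 1 - fps_X ^ t * (fps_X ^ t) ^ i) m)" (is "_ has_prod ?P")
proof -
  have "(\<lambda>n. \<Prod>i\<le>n. 1 - fps_X ^ t * (fps_X ^ t) ^ i :: real fps) \<longlonglongrightarrow> ?P"
  proof (rule tendsto_fpsI)
    fix m
    show "\<forall>\<^sub>F n in sequentially.
            fps_nth (\<Prod>i\<le>n. 1 - fps_X ^ t * (fps_X ^ t) ^ i) m = fps_nth ?P m"
      using eventually_ge_at_top[of m]
      by eventually_elim (unfold fps_nth_Abs_fps, rule partial_prod_nth_stable[OF assms])
  qed
  moreover have "fps_nth ?P 0 = 1"
    using assms by simp
  hence "?P \<noteq> 0"
    by (metis fps_zero_nth zero_neq_one)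
  ultimately show ?thesis
    by (simp add: has_prod_def raw_has_prod_def)
qed

lemma qpochhammer_inf_fps_nth:
  assumes "t > 0"
  shows "fps_nth (qpochhammer_inf (fps_X ^ t) (fps_X ^ t) :: real fps) m =
         fps_nth (\<Prod>i\<le>m. 1 - fps_X ^ t * (fps_X ^ t) ^ i) m"
  unfolding qpochhammer_inf_def has_prod_unique[OF has_prod_qpochhammer_fps[OF assms], symmetric]
  by (rule fps_nth_Abs_fps)

lemma qpochhammer_inf_fps_power_nth_0:
  assumes "t > 0"
  shows "fps_nth (qpochhammer_inf (fps_X ^ t) (fps_X ^ t) ^ r :: real fps) 0 = 1"
  using assms by (simp add: fps_nth_power_0 qpochhammer_inf_fps_nth zero_power)

lemma H_gf_mult:
  assumes "t > 0"
  shows "H_gf r t * qpochhammer_inf (fps_X ^ t) (fps_X ^ t) ^ r = 1"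
  unfolding H_gf_def using qpochhammer_inf_fps_power_nth_0[OF assms, of r]
  by (simp add: fps_divide_unit inverse_mult_eq_1)

lemma Ints_fps_nth_mult:
  fixes f g :: "real fps"
  assumes "\<And>n. fps_nth f n \<in> \<int>" "\<And>n. fps_nth g n \<in> \<int>"
  shows "fps_nth (f * g) n \<in> \<int>"
  unfolding fps_mult_nth by (intro Ints_sum Ints_mult assms)

lemma Ints_fps_nth_prod:
  fixes f :: "nat \<Rightarrow> real fps"
  assumes "\<And>i n. fps_nth (f i) n \<in> \<int>"
  shows "fps_nth (\<Prod>i\<in>A. f i) n \<in> \<int>"
proof (induction A arbitrary: n rule: infinite_finite_induct)
  case (insert x A)
  show ?case unfolding prod.insert[OF insert.hyps]
    by (intro Ints_fps_nth_mult assms insert.IH)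
qed auto

lemma qpochhammer_inf_fps_power_nth_Ints:
  assumes "t > 0"
  shows "fps_nth (qpochhammer_inf (fps_X ^ t) (fps_X ^ t) ^ r :: real fps) n \<in> \<int>"
proof -
  have factor: "fps_nth (1 - fps_X ^ t * (fps_X ^ t) ^ i :: real fps) n \<in> \<int>" for i n
  proof -
    have "fps_X ^ t * (fps_X ^ t) ^ i = (fps_X ^ (t * Suc i) :: real fps)"
      by (simp add: power_add power_mult)
    thus ?thesis by (simp only: fps_sub_nth fps_one_nth fps_X_power_nth) auto
  qed
  have "fps_nth (qpochhammer_inf (fps_X ^ t) (fps_X ^ t) :: real fps) n \<in> \<int>" for n
    unfolding qpochhammer_inf_fps_nth[OF assms] by (intro Ints_fps_nth_prod factor)
  hence "fps_nth (\<Prod>i<r. qpochhammer_inf (fps_X ^ t) (fps_X ^ t) :: real fps) n \<in> \<int>"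
    by (intro Ints_fps_nth_prod)
  thus ?thesis by simp
qed

lemma c_coeff_in_Ints:
  assumes "t > 0"
  shows "c_coeff r t n \<in> \<int>"
proof -
  define G :: "real fps" where "G = qpochhammer_inf (fps_X ^ t) (fps_X ^ t) ^ r"
  have G: "fps_nth G m \<in> \<int>" for m
    unfolding G_def by (rule qpochhammer_inf_fps_power_nth_Ints[OF assms])
  have G0: "fps_nth G 0 = 1"
    unfolding G_def by (rule qpochhammer_inf_fps_power_nth_0[OF assms])
  have eq: "H_gf r t * G = 1"
    unfolding G_def by (rule H_gf_mult[OF assms])
  have "fps_nth (H_gf r t) n \<in> \<int>"
  proof (induction n rule: less_induct)
    case (less n)
    have "{0..n} = insert n {..<n}"
      by auto
    hence "fps_nth (H_gf r t * G) n =
            fps_nth (H_gf r t) n + (\<Sum>i<n. fps_nth (H_gf r t) i * fps_nth G (n - i))"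
      by (simp add: fps_mult_nth G0)
    hence "fps_nth (H_gf r t) n =
             fps_nth 1 n - (\<Sum>i<n. fps_nth (H_gf r t) i * fps_nth G (n - i))"
      by (simp add: eq)
    also have "\<dots> \<in> \<int>"
      by (intro Ints_diff Ints_sum Ints_mult G less.IH) (auto simp: fps_one_nth)
    finally show ?case .
  qed
  thus ?thesis by (simp add: c_coeff_def)
qed

end

theory Submission
  imports
    Defs
    "HOL-Probability.Probability"
    "Jordan_Normal_Form.Char_Poly"
begin

text \<open>
  Write \<open>q = exp (- z)\<close>. The sequence \<open>C(n)\<close> has generating function
  \<open>exp (\<Sum>m. b\<^sub>m exp (- m z))\<close> with \<open>b\<^sub>m \<ge> 0\<close>, and the proof is a saddle point argument for Cauchy's
  formula that treats a whole Jensen polynomial at once. Since \<open>C(n+j)\<close> is the integral of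
  the generating function against \<open>exp ((n + j) z)\<close>, the binomial theorem turns
  \<open>\<Sum>j. (d choose j) C(n+j) Y\<^sup>j\<close> into the integral that represents \<open>C(n)\<close>, with the additional
  factor \<open>(1 + Y exp z)\<^sup>d\<close>. Integrate over \<open>z = s + i u/\<sigma>\<close>, where \<open>s\<close> is the saddle point for \<open>n\<close>
  and \<open>\<sigma>\<^sup>2 = \<Sum>m. m\<^sup>2 b\<^sub>m exp (- m s)\<close>. For \<open>Y = (\<delta> X - 1) / exp s\<close> with \<open>\<delta> = 1 / (sqrt 2 \<sigma>)\<close>
  that factor is \<open>\<delta>\<^sup>d\<close> times something that tends to \<open>(X - i sqrt 2 u)\<^sup>d\<close>, while the rest of the
  integrand tends, up to a factor that \<open>C(n)\<close> shares, to the Gaussian \<open>exp (- u\<^sup>2/2)\<close>. The normalised Jensen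
  polynomials therefore converge to the mean of \<open>(X - i sqrt 2 U)\<^sup>d\<close> for a standard normal \<open>U\<close>,
  whose exponential generating function in \<open>d\<close> is \<open>exp (X t - t\<^sup>2)\<close>: it is the Hermite
  polynomial. Dominated convergence justifies the passage to the limit under the integral.

  The generating function is identified in \<open>H_gf_sums_to_exp\<close>. The Gaussian limit
  (\<open>wave_tendsto\<close>) is a third order Taylor estimate, and it needs the third moment of the \<open>b\<^sub>m\<close> to
  be small compared with \<open>\<sigma>\<^sup>3\<close>. The domination (\<open>norm_integrand_le\<close>) rests on
  \<open>rescaled_exponent_ge\<close>, a lower bound for the decay of the integrand that is uniform on the
  whole circle. Both rest on \<open>b\<^sub>m \<ge> 1\<close> for \<open>m \<ge> 1\<close> and on the bound \<open>O(1/s)\<close> for the sum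
  \<open>\<Sum>m. b\<^sub>m exp (- m s)\<close>, which together give \<open>\<sigma>\<^sup>2\<close> the exact order \<open>1/s\<^sup>3\<close>.

  The Hermite polynomial of degree \<open>d\<close> takes alternating signs at \<open>d + 1\<close> points
  (\<open>hermite_alternates\<close>), so the Jensen polynomials of large shift do too and have \<open>d\<close> real
  zeros. For real zeros the Hankel matrix of power sums is positive semidefinite, hence its
  determinant is nonnegative, which gives the Turan inequalities.
\<close>

section \<open>Real power series at complex arguments\<close>

text \<open>
  Absolute summability is part of the predicate because it makes the predicate stable under
  Cauchy products.
\<close>

definition fps_sums_to :: "real fps \<Rightarrow> complex \<Rightarrow> complex \<Rightarrow> bool" where
  "fps_sums_to f q v \<longleftrightarrow> summable (\<lambda>m. norm (of_real (fps_nth f m) * q ^ m)) \<and>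
     (\<lambda>m. of_real (fps_nth f m) * q ^ m) sums v"

lemma fps_sums_to_mult:
  assumes "fps_sums_to f q v" "fps_sums_to g q w"
  shows "fps_sums_to (f * g) q (v * w)"
proof -
  let ?a = "\<lambda>m. complex_of_real (fps_nth f m) * q ^ m" and ?b = "\<lambda>m. complex_of_real (fps_nth g m) * q ^ m"
  have eq: "complex_of_real (fps_nth (f * g) m) * q ^ m = (\<Sum>i\<le>m. ?a i * ?b (m - i))" for m
    unfolding fps_mult_nth of_real_sum sum_distrib_right atLeast0AtMost
    by (rule sum.cong) (auto simp: mult_ac simp flip: power_add)
  have a: "summable (\<lambda>m. norm (?a m))" "suminf ?a = v" and b: "summable (\<lambda>m. norm (?b m))" "suminf ?b = w"
    using assms by (auto simp: fps_sums_to_def sums_iff)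
  have "summable (\<lambda>m. \<Sum>i\<le>m. norm (?a i) * norm (?b (m - i)))"
    using Cauchy_product_sums[of "\<lambda>m. norm (?a m)" "\<lambda>m. norm (?b m)"] a(1) b(1) by (auto simp: sums_iff)
  hence "summable (\<lambda>m. norm (\<Sum>i\<le>m. ?a i * ?b (m - i)))"
    by (rule summable_comparison_test'[where N = 0])
       (auto simp flip: norm_mult intro!: sum_norm_le)
  moreover have "(\<lambda>m. \<Sum>i\<le>m. ?a i * ?b (m - i)) sums (v * w)"
    using Cauchy_product_sums[OF a(1) b(1)] a(2) b(2) by simp
  ultimately show ?thesis unfolding fps_sums_to_def eq by blast
qed

lemma fps_sums_to_1: "fps_sums_to 1 q 1"
proof -
  have "complex_of_real (fps_nth 1 m) * q ^ m = (if m = 0 then 1 else 0)" for m by auto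
  moreover have "(\<lambda>m. if m = 0 then 1 else 0 :: complex) sums 1"
    using sums_single[of 0 "\<lambda>_. 1 :: complex"] by simp
  moreover have "summable (\<lambda>m. norm (if m = 0 then 1 else 0 :: complex))"
    by (rule summable_finite[of "{0}"]) auto
  ultimately show ?thesis unfolding fps_sums_to_def by presburger
qed

lemma fps_sums_to_prod:
  assumes "\<And>k. k \<in> K \<Longrightarrow> fps_sums_to (f k) q (v k)"
  shows "fps_sums_to (\<Prod>k\<in>K. f k) q (\<Prod>k\<in>K. v k)"
  using assms by (induction K rule: infinite_finite_induct) (auto intro: fps_sums_to_mult fps_sums_to_1)

lemma fps_sums_to_power: "fps_sums_to f q v \<Longrightarrow> fps_sums_to (f ^ n) q (v ^ n)"
  by (induction n) (auto intro: fps_sums_to_mult fps_sums_to_1)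

lemma fps_sums_to_add:
  assumes "fps_sums_to f q v" "fps_sums_to g q w"
  shows "fps_sums_to (f + g) q (v + w)"
proof -
  have "summable (\<lambda>m. norm (of_real (fps_nth f m) * q ^ m + of_real (fps_nth g m) * q ^ m))"
    by (rule summable_comparison_test'[OF summable_add[of "\<lambda>m. norm (of_real (fps_nth f m) * q ^ m)"
         "\<lambda>m. norm (of_real (fps_nth g m) * q ^ m)"], of 0])
       (use assms in \<open>auto simp: fps_sums_to_def norm_triangle_ineq\<close>)
  thus ?thesis using assms sums_add[of "\<lambda>m. of_real (fps_nth f m) * q ^ m" v "\<lambda>m. of_real (fps_nth g m) * q ^ m" w]
    by (simp add: fps_sums_to_def ring_distribs)
qed

lemma fps_sums_to_sum:
  assumes "\<And>k. k \<in> K \<Longrightarrow> fps_sums_to (f k) q (v k)"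
  shows "fps_sums_to (\<Sum>k\<in>K. f k) q (\<Sum>k\<in>K. v k)"
proof -
  have "fps_sums_to 0 q 0" by (simp add: fps_sums_to_def)
  with assms show ?thesis
    by (induction K rule: infinite_finite_induct) (auto intro: fps_sums_to_add)
qed

lemma fps_sums_to_const_mult: "fps_sums_to f q v \<Longrightarrow> fps_sums_to (fps_const c * f) q (of_real c * v)"
  by (auto simp: fps_sums_to_def mult.assoc norm_mult intro: sums_mult summable_mult)

lemma fps_sums_to_multiples:
  assumes k: "k > 0" and q: "norm q < 1"
    and f: "fps_sums_to f (q ^ k) v"
  shows "fps_sums_to (Abs_fps (\<lambda>m. if k dvd m then fps_nth f (m div k) else 0)) q v"
proof -
  \<comment> \<open>The series for \<open>q\<close> is the series for \<open>q ^ k\<close> spread out over the multiples of \<open>k\<close>.\<close>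
  have mono: "strict_mono (\<lambda>i. k * i)" using k by (simp add: strict_mono_def)
  let ?g = "\<lambda>m. complex_of_real (fps_nth (Abs_fps (\<lambda>m. if k dvd m then fps_nth f (m div k) else 0)) m) * q ^ m"
  have *: "?g (k * i) = of_real (fps_nth f i) * (q ^ k) ^ i" for i
    using k by (simp add: power_mult)
  have zero: "?g n = 0" if "n \<notin> range (\<lambda>i. k * i)" for n
    using that by (auto simp: dvd_def)
  have "?g sums v"
    using f sums_mono_reindex[OF mono, where f = ?g and c = v] zero unfolding * fps_sums_to_def by blast
  moreover have "summable (\<lambda>m. norm (?g m))"
    using f summable_mono_reindex[OF mono, where f = "\<lambda>m. norm (?g m)"] zero
    unfolding * fps_sums_to_def norm_eq_zero by blast
  ultimately show ?thesis by (simp add: fps_sums_to_def)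
qed

section \<open>The coefficients of the logarithm of the generating function\<close>

lemma exp_ge_power_over_fact:
  fixes x :: real
  assumes "x \<ge> 0" shows "x ^ n / fact n \<le> exp x"
proof -
  have "(\<lambda>n. x ^ n / fact n) sums exp x" using exp_converges[of x] by (simp add: divide_inverse_commute scaleR_conv_of_real)
  from sum_le_suminf[OF sums_summable[OF this], of "{n}"] this assms show ?thesis
    by (auto simp: sums_iff)
qed

text \<open>
  Half of the exponential absorbs the power. This reduces every moment estimate below to the
  estimate of a sum without powers, at \<open>s / 2\<close>.
\<close>

lemma power_times_exp_minus_le:
  fixes s :: real
  assumes "s > 0"
  shows "real m ^ j * exp (- (real m * s)) \<le> fact j * (2 / s) ^ j * exp (- (real m * (s / 2)))"
proof -
  have "(real m * (s / 2)) ^ j / fact j \<le> exp (real m * (s / 2))"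
    using assms by (intro exp_ge_power_over_fact) auto
  hence "real m ^ j * ((s / 2) ^ j / fact j) * exp (- (real m * s)) \<le> exp (real m * (s / 2)) * exp (- (real m * s))"
    by (intro mult_right_mono) (auto simp: power_mult_distrib power_divide)
  also have "\<dots> = exp (- (real m * (s / 2)))" by (simp flip: exp_add add: field_simps)
  finally have "real m ^ j * exp (- (real m * s)) * ((s / 2) ^ j / fact j) \<le> exp (- (real m * (s / 2)))" by (simp add: mult_ac)
  moreover have "(s / 2) ^ j / fact j > 0" using assms by simp
  ultimately have "real m ^ j * exp (- (real m * s)) \<le> exp (- (real m * (s / 2))) / ((s / 2) ^ j / fact j)"
    using mult_imp_le_div_pos by blast
  thus ?thesis by (simp add: power_divide field_simps)
qed

lemma summable_power_times_exp_minus: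
  fixes s :: real
  assumes "s > 0"
  shows "summable (\<lambda>m. real m ^ j * exp (- (real m * s)))"
proof (rule summable_comparison_test')
  have "summable (\<lambda>m. fact j * (2 / s) ^ j * exp (- (s / 2)) ^ m)"
    by (intro summable_mult summable_geometric) (use assms in auto)
  thus "summable (\<lambda>m. fact j * (2 / s) ^ j * exp (- (real m * (s / 2))))"
    by (simp flip: exp_of_nat_mult)
qed (use power_times_exp_minus_le[OF assms] in \<open>auto simp: abs_mult\<close>)

text \<open>
  The coefficient of \<open>q\<^sup>m\<close> in \<open>- r \<Sum>k. ln (1 - q\<^sup>k) = r \<Sum>k. \<Sum>l. q\<^sup>k\<^sup>l / l\<close>. A divisor \<open>k\<close> of \<open>m\<close>
  contributes \<open>1 / l = k / m\<close>. For \<open>m = 0\<close> the sum is empty.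
\<close>

definition log_coeff :: "nat \<Rightarrow> nat \<Rightarrow> real" where
  "log_coeff r m = real r * (\<Sum>k=1..m. if k dvd m then real k / real m else 0)"

lemma log_coeff_nonneg: "log_coeff r m \<ge> 0"
  by (auto simp: log_coeff_def intro!: mult_nonneg_nonneg sum_nonneg)

lemma log_coeff_le: "log_coeff r m \<le> real r * real m"
proof -
  have "(\<Sum>k=1..m. if k dvd m then real k / real m else 0) \<le> (\<Sum>k=1..m. 1)"
    by (intro sum_mono) auto
  thus ?thesis by (auto simp: log_coeff_def intro!: mult_left_mono)
qed

lemma log_coeff_ge_1:
  assumes "r > 0" "m > 0" shows "log_coeff r m \<ge> 1"
proof -
  \<comment> \<open>The divisor \<open>k = m\<close> alone contributes 1.\<close>
  have "(\<Sum>k\<in>{m}. if k dvd m then real k / real m else 0) \<le> (\<Sum>k=1..m. if k dvd m then real k / real m else 0)"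
    by (intro sum_mono2) (use assms in auto)
  hence "1 \<le> (\<Sum>k=1..m. if k dvd m then real k / real m else 0)" using assms by simp
  hence "1 * 1 \<le> log_coeff r m"
    unfolding log_coeff_def using assms by (intro mult_mono) auto
  thus ?thesis by simp
qed

lemma summable_log_coeff:
  fixes s :: real
  assumes "s > 0"
  shows "summable (\<lambda>m. log_coeff r m * real m ^ j * exp (- (real m * s)))"
proof (rule summable_comparison_test')
  show "summable (\<lambda>m. real r * (real m ^ Suc j * exp (- (real m * s))))"
    by (intro summable_mult summable_power_times_exp_minus assms)
  show "norm (log_coeff r m * real m ^ j * exp (- (real m * s))) \<le> real r * (real m ^ Suc j * exp (- (real m * s)))" for m
    using mult_right_mono[OF log_coeff_le[of r m], of "real m ^ j * exp (- (real m * s))"] log_coeff_nonneg[of r m]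
    by (simp add: abs_mult mult_ac)
qed

lemma summable_log_coeff_power:
  fixes x :: real
  assumes "0 \<le> x" "x < 1"
  shows "summable (\<lambda>m. log_coeff r m * x ^ m)"
proof (cases "x = 0")
  case False
  with assms have "x > 0" by simp
  hence "x ^ m = exp (- (real m * (- ln x)))" for m
    by (simp add: exp_of_nat_mult)
  thus ?thesis using summable_log_coeff[of "- ln x" r 0] assms \<open>x > 0\<close> by simp
next
  case True
  thus ?thesis by (intro summable_finite[of "{0}"]) auto
qed

section \<open>The generating function as an exponential\<close>

text \<open>
  The form in which Tannery's theorem is used, once for the truncated products and once for their
  logarithms: coefficients that increase to their final value and reach it after finitely many steps.
\<close>

lemma tendsto_suminf_stabilising_coeffs:
  fixes a :: "nat \<Rightarrow> nat \<Rightarrow> real" and q :: complex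
  assumes sm: "summable (\<lambda>m. c m * norm q ^ m)"
    and nn: "\<And>N m. 0 \<le> a N m" and le: "\<And>N m. a N m \<le> c m" and eq: "\<And>N m. m < N \<Longrightarrow> a N m = c m"
  shows "(\<lambda>N. \<Sum>m. of_real (a N m) * q ^ m) \<longlonglongrightarrow> (\<Sum>m. of_real (c m) * q ^ m)"
    and "summable (\<lambda>m. norm (of_real (c m) * q ^ m))"
proof -
  have "eventually (\<lambda>N. of_real (a N m) * q ^ m = of_real (c m) * q ^ m) sequentially" for m
    using eventually_gt_at_top[of m] by eventually_elim (simp add: eq)
  hence lim: "((\<lambda>N. of_real (a N m) * q ^ m) \<longlongrightarrow> of_real (c m) * q ^ m) sequentially" for m
    by (rule tendsto_eventually)
  have "norm (of_real (a N m) * q ^ m) \<le> c m * norm q ^ m" for N m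
    using nn[of N m] le[of N m] by (auto simp: norm_mult norm_power intro!: mult_right_mono)
  hence bd: "eventually (\<lambda>(m, N). norm (of_real (a N m) * q ^ m) \<le> c m * norm q ^ m) (at_top \<times>\<^sub>F sequentially)"
    by (intro always_eventually) auto
  from tannerys_theorem[OF lim bd sm]
  show "(\<lambda>N. \<Sum>m. of_real (a N m) * q ^ m) \<longlonglongrightarrow> (\<Sum>m. of_real (c m) * q ^ m)"
    and "summable (\<lambda>m. norm (of_real (c m) * q ^ m))" by auto
qed

definition geom_fps :: "nat \<Rightarrow> real fps" where
  "geom_fps k = Abs_fps (\<lambda>m. if k dvd m then 1 else 0)"

lemma geom_fps_mult: assumes "k > 0" shows "geom_fps k * (1 - fps_X ^ k) = 1"
proof -
  have k: "fps_nth (fps_X ^ k :: real fps) 0 = 0" using assms by simp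
  have "geom_fps k = Abs_fps (\<lambda>_. 1) oo fps_X ^ k"
    by (rule fps_ext) (simp add: geom_fps_def fps_nth_compose_X_power)
  moreover have "1 - fps_X ^ k = (1 - fps_X :: real fps) oo fps_X ^ k"
    using k by (simp add: fps_compose_sub_distrib)
  moreover have "Abs_fps (\<lambda>_. 1) * (1 - fps_X :: real fps) = 1"
    by (rule fps_ext) (simp add: algebra_simps)
  ultimately show ?thesis using k by (simp flip: fps_compose_mult_distrib)
qed

lemma fps_sums_to_geom:
  assumes "k > 0" "norm q < 1"
  shows "fps_sums_to (geom_fps k) q (1 / (1 - q ^ k))"
proof -
  have "norm (q ^ k) < 1" using assms by (simp add: norm_power power_less_one_iff)
  hence "fps_sums_to (Abs_fps (\<lambda>_. 1)) (q ^ k) (1 / (1 - q ^ k))"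
    unfolding fps_sums_to_def by (auto simp: norm_power intro!: geometric_sums summable_geometric)
  from fps_sums_to_multiples[OF assms this] show ?thesis
    by (simp add: geom_fps_def cong: if_cong)
qed

text \<open>
  The series of \<open>- ln (1 - X\<^sup>k)\<close>. At \<open>m = 0\<close> the quotient is 0 by convention, as it should be.
\<close>

definition log_fps :: "nat \<Rightarrow> real fps" where
  "log_fps k = Abs_fps (\<lambda>m. if k dvd m then real k / real m else 0)"

lemma fps_sums_to_log:
  assumes "k > 0" "norm q < 1"
  shows "fps_sums_to (log_fps k) q (- ln (1 - q ^ k))"
proof -
  have q: "norm (q ^ k) < 1" using assms by (simp add: norm_power power_less_one_iff)
  have "(\<lambda>n. of_real (1 / real n) * (q ^ k) ^ n) sums - ln (1 - q ^ k)"
    using sums_minus[OF Ln_series'[of "- (q ^ k)"]] q by (simp add: divide_inverse mult_ac)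
  moreover have "summable (\<lambda>n. norm (of_real (1 / real n) * (q ^ k) ^ n))"
  proof (rule summable_comparison_test')
    show "summable (\<lambda>n. norm (q ^ k) ^ n)" using q by (intro summable_geometric) auto
    show "norm (norm (of_real (1 / real n) * (q ^ k) ^ n)) \<le> norm (q ^ k) ^ n" for n
      by (cases "n = 0") (auto simp: norm_mult norm_divide norm_power divide_le_eq mult_le_cancel_left1)
  qed
  ultimately have "fps_sums_to (Abs_fps (\<lambda>n. 1 / real n)) (q ^ k) (- ln (1 - q ^ k))"
    by (simp add: fps_sums_to_def)
  from fps_sums_to_multiples[OF assms this] show ?thesis
    using assms(1) by (simp add: log_fps_def real_of_nat_div cong: if_cong)
qed

lemma fps_sums_to_unique: "fps_sums_to f q v \<Longrightarrow> fps_sums_to f q w \<Longrightarrow> v = w"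
  by (auto simp: fps_sums_to_def intro: sums_unique2)

definition partial_gf :: "nat \<Rightarrow> nat \<Rightarrow> real fps" where
  "partial_gf r N = (\<Prod>k=1..N. geom_fps k) ^ r"

definition partial_log :: "nat \<Rightarrow> nat \<Rightarrow> real fps" where
  "partial_log r N = fps_const (real r) * (\<Sum>k=1..N. log_fps k)"

lemma partial_gf_eq_exp_partial_log:
  assumes "norm q < 1" "fps_sums_to (partial_log r N) q v"
  shows "fps_sums_to (partial_gf r N) q (exp v)"
proof -
  have "fps_sums_to (partial_log r N) q (of_real (real r) * (\<Sum>k=1..N. - ln (1 - q ^ k)))"
    unfolding partial_log_def
    by (intro fps_sums_to_const_mult fps_sums_to_sum fps_sums_to_log assms) auto
  hence v: "v = of_nat r * (\<Sum>k=1..N. - ln (1 - q ^ k))"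
    using fps_sums_to_unique[OF assms(2)] by simp
  have "1 - q ^ k \<noteq> 0" if "k \<ge> 1" for k
  proof
    assume "1 - q ^ k = 0"
    hence "norm (q ^ k) = 1" by simp
    moreover have "norm (q ^ k) < 1" using assms(1) that by (simp add: norm_power power_less_one_iff)
    ultimately show False by simp
  qed
  hence "exp v = (\<Prod>k=1..N. 1 / (1 - q ^ k)) ^ r"
    unfolding v exp_of_nat_mult by (subst exp_sum) (auto simp: exp_minus divide_inverse intro!: prod.cong)
  moreover have "fps_sums_to (partial_gf r N) q ((\<Prod>k=1..N. 1 / (1 - q ^ k)) ^ r)"
    unfolding partial_gf_def
    by (intro fps_sums_to_power fps_sums_to_prod fps_sums_to_geom assms) auto
  ultimately show ?thesis by simp
qed

lemma partial_log_coeffs: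
  shows "fps_nth (partial_log r N) m \<ge> 0"
    and "fps_nth (partial_log r N) m \<le> log_coeff r m"
    and "m < N \<Longrightarrow> fps_nth (partial_log r N) m = log_coeff r m"
proof -
  let ?f = "\<lambda>k. if k dvd m then real k / real m else 0"
  have nth: "fps_nth (partial_log r N) m = real r * sum ?f {1..N}"
    by (simp add: partial_log_def log_fps_def fps_sum_nth)
  show "fps_nth (partial_log r N) m \<ge> 0"
    unfolding nth by (auto intro!: mult_nonneg_nonneg sum_nonneg)
  have cut: "sum ?f {1..N} = sum ?f {1..min N m}"
    by (rule sum.mono_neutral_right) (auto dest: dvd_imp_le)
  show "fps_nth (partial_log r N) m \<le> log_coeff r m"
    unfolding nth cut log_coeff_def by (intro mult_left_mono sum_mono2) auto
  show "fps_nth (partial_log r N) m = log_coeff r m" if "m < N"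
    using that unfolding nth cut log_coeff_def by simp
qed

lemma fps_nonneg_mult_ge:
  fixes f g :: "real fps"
  assumes "\<And>m. fps_nth f m \<ge> 0" "\<And>m. fps_nth g m \<ge> 0" "fps_nth g 0 = 1"
  shows "fps_nth f m \<le> fps_nth (f * g) m"
proof -
  have "(\<Sum>i\<in>{m}. fps_nth f i * fps_nth g (m - i)) \<le> (\<Sum>i=0..m. fps_nth f i * fps_nth g (m - i))"
    by (intro sum_mono2) (auto simp: assms)
  thus ?thesis by (simp add: fps_mult_nth assms(3))
qed

lemma fps_nonneg_mult:
  fixes f g :: "real fps"
  assumes "\<And>m. fps_nth f m \<ge> 0" "\<And>m. fps_nth g m \<ge> 0"
  shows "fps_nth (f * g) m \<ge> 0"
  unfolding fps_mult_nth by (intro sum_nonneg mult_nonneg_nonneg assms)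

lemma fps_nonneg_power:
  fixes f :: "real fps"
  assumes "\<And>m. fps_nth f m \<ge> 0"
  shows "fps_nth (f ^ n) m \<ge> 0"
  by (induction n arbitrary: m) (auto intro!: fps_nonneg_mult assms)

lemma geom_fps_power_nonneg: "fps_nth (geom_fps k ^ r) m \<ge> 0"
  by (rule fps_nonneg_power) (simp add: geom_fps_def)

lemma partial_gf_Suc: "partial_gf r (Suc N) = partial_gf r N * geom_fps (Suc N) ^ r"
  by (simp add: partial_gf_def power_mult_distrib)

lemma partial_gf_nonneg: "fps_nth (partial_gf r N) m \<ge> 0"
proof (induction N arbitrary: m)
  case (Suc N)
  thus ?case unfolding partial_gf_Suc by (intro fps_nonneg_mult geom_fps_power_nonneg)
qed (simp add: partial_gf_def)

text \<open>
  Each further factor is a power of a geometric series, with nonnegative coefficients and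
  constant term 1, so multiplication by it can only increase coefficients.
\<close>

lemma partial_gf_mono: "N \<le> M \<Longrightarrow> fps_nth (partial_gf r N) m \<le> fps_nth (partial_gf r M) m"
proof (induction M rule: dec_induct)
  case (step M)
  have "fps_nth (partial_gf r M) m \<le> fps_nth (partial_gf r (Suc M)) m"
    unfolding partial_gf_Suc
    by (intro fps_nonneg_mult_ge partial_gf_nonneg geom_fps_power_nonneg)
       (simp add: geom_fps_def fps_nth_power_0)
  thus ?case using step by simp
qed simp

lemma fps_mult_agree_below:
  fixes f g f' g' :: "real fps"
  assumes "\<And>m. m < N \<Longrightarrow> fps_nth f m = fps_nth f' m" "\<And>m. m < N \<Longrightarrow> fps_nth g m = fps_nth g' m" "m < N"
  shows "fps_nth (f * g) m = fps_nth (f' * g') m"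
  unfolding fps_mult_nth by (rule sum.cong) (use assms in auto)

text \<open>
  The truncated denominator agrees with the full one below degree \<open>N\<close>. Multiplying the truncated
  quotient by the product of the full quotient and its denominator, which is 1, and exchanging
  the full denominator for the truncated one transfers the agreement to the quotients.
\<close>

lemma partial_gf_agree:
  assumes "m < N"
  shows "fps_nth (partial_gf r N) m = fps_nth (H_gf r 1) m"
proof -
  have pos_1: "(0 :: nat) < 1" by simp
  define Q :: "real fps" where "Q = (\<Prod>k=1..N. 1 - fps_X ^ k)"
  define D :: "real fps" where "D = qpochhammer_inf (fps_X ^ 1) (fps_X ^ 1)"
  have "fps_nth D m = fps_nth Q m" if "m < N" for m
  proof -
    have "Q = (\<Prod>i\<le>N - 1. 1 - fps_X ^ 1 * (fps_X ^ 1) ^ i)"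
      unfolding Q_def
      by (rule prod.reindex_bij_witness[of _ Suc "\<lambda>k. k - 1"]) (use that in \<open>auto simp flip: power_Suc\<close>)
    thus ?thesis
      unfolding D_def using that
      by (simp only: qpochhammer_inf_fps_nth[OF pos_1] partial_prod_nth_stable[OF pos_1, of m "N - 1", symmetric])
  qed
  hence "fps_nth (D ^ j) m = fps_nth (Q ^ j) m" if "m < N" for m j
    using that by (induction j arbitrary: m) (auto intro!: fps_mult_agree_below[where N = N])
  note agree = this
  have GD: "H_gf r 1 * D ^ r = 1" unfolding D_def by (rule H_gf_mult) simp
  have PQ: "partial_gf r N * Q ^ r = 1"
    unfolding partial_gf_def Q_def
    by (simp add: power_mult_distrib[symmetric] prod.distrib[symmetric] geom_fps_mult)
  have "fps_nth (partial_gf r N) m = fps_nth ((partial_gf r N * H_gf r 1) * D ^ r) m"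
    by (simp only: mult.assoc GD mult_1_right)
  also have "\<dots> = fps_nth ((partial_gf r N * H_gf r 1) * Q ^ r) m"
    by (rule fps_mult_agree_below[where N = N]) (use assms agree in auto)
  also have "(partial_gf r N * H_gf r 1) * Q ^ r = H_gf r 1"
    using PQ by (metis mult.assoc mult.commute mult_1)
  finally show ?thesis .
qed

text \<open>
  For the truncated products the identity is the logarithm series of finitely many factors.
  Both sides pass to the limit by dominated convergence. The dominating series on the left is
  \<open>\<Sum>m. C(m) |q|\<^sup>m\<close>; its partial sums coincide with partial sums of the series of truncated products,
  which are at most the exponential on the right, taken at \<open>|q|\<close>.
\<close>

theorem H_gf_sums_to_exp:
  assumes q: "norm q < 1"
  shows "fps_sums_to (H_gf r 1) q (exp (\<Sum>m. of_real (log_coeff r m) * q ^ m))"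
proof -
  define C where "C = fps_nth (H_gf r 1)"
  have C_nonneg: "C m \<ge> 0" for m
    using partial_gf_agree[of m "Suc m" r] partial_gf_nonneg[of r "Suc m" m] by (simp add: C_def)
  have le_C: "fps_nth (partial_gf r N) m \<le> C m" for N m
    using partial_gf_agree[of m "max N (Suc m)" r] partial_gf_mono[of N "max N (Suc m)" r m]
    by (simp add: C_def)
  define \<rho> where "\<rho> = norm q"
  have \<rho>: "0 \<le> \<rho>" "\<rho> < 1" using q by (auto simp: \<rho>_def)
  have log_sums: "fps_sums_to (partial_log r N) z (\<Sum>m. of_real (fps_nth (partial_log r N) m) * z ^ m)"
    if "norm z = \<rho>" for N z
  proof -
    have "fps_sums_to (partial_log r N) z (of_real (real r) * (\<Sum>k=1..N. - ln (1 - z ^ k)))"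
      unfolding partial_log_def
      by (intro fps_sums_to_const_mult fps_sums_to_sum fps_sums_to_log) (use that \<rho> in auto)
    thus ?thesis by (auto simp: fps_sums_to_def intro: summable_sums sums_summable)
  qed
  have gf_sums: "fps_sums_to (partial_gf r N) z (exp (\<Sum>m. of_real (fps_nth (partial_log r N) m) * z ^ m))"
    if "norm z = \<rho>" for N z
    by (rule partial_gf_eq_exp_partial_log[OF _ log_sums]) (use that \<rho> in auto)
  have sm_log: "summable (\<lambda>m. log_coeff r m * \<rho> ^ m)" by (rule summable_log_coeff_power[OF \<rho>])
  have "summable (\<lambda>m. C m * \<rho> ^ m)"
  proof (rule summableI_nonneg_bounded)
    show "0 \<le> C m * \<rho> ^ m" for m using C_nonneg \<rho> by simp
    fix M
    have real_log: "summable (\<lambda>m. fps_nth (partial_log r M) m * \<rho> ^ m)"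
      by (rule summable_comparison_test'[OF sm_log, of 0])
         (use partial_log_coeffs \<rho> in \<open>auto simp: abs_mult intro!: mult_right_mono\<close>)
    have "fps_sums_to (partial_gf r M) (of_real \<rho>) (of_real (exp (\<Sum>m. fps_nth (partial_log r M) m * \<rho> ^ m)))"
      using gf_sums[of "of_real \<rho>" M] \<rho> suminf_of_real[OF real_log, where 'a = complex]
      by (simp flip: exp_of_real)
    hence *: "(\<lambda>m. fps_nth (partial_gf r M) m * \<rho> ^ m) sums exp (\<Sum>m. fps_nth (partial_log r M) m * \<rho> ^ m)"
      unfolding fps_sums_to_def by (subst sums_of_real_iff[symmetric, where 'a = complex]) simp
    have "(\<Sum>m<M. C m * \<rho> ^ m) = (\<Sum>m<M. fps_nth (partial_gf r M) m * \<rho> ^ m)"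
      by (intro sum.cong) (auto simp: C_def partial_gf_agree)
    also have "\<dots> \<le> exp (\<Sum>m. fps_nth (partial_log r M) m * \<rho> ^ m)"
      unfolding sums_unique[OF *]
      by (intro sum_le_suminf sums_summable[OF *]) (use partial_gf_nonneg \<rho> in auto)
    also have "\<dots> \<le> exp (\<Sum>m. log_coeff r m * \<rho> ^ m)"
      by (subst exp_le_cancel_iff, intro suminf_le real_log sm_log mult_right_mono partial_log_coeffs) (use \<rho> in auto)
    finally show "(\<Sum>m<M. C m * \<rho> ^ m) \<le> exp (\<Sum>m. log_coeff r m * \<rho> ^ m)" .
  qed
  hence sm_C: "summable (\<lambda>m. C m * norm q ^ m)" by (simp add: \<rho>_def)
  have eq_C: "m < N \<Longrightarrow> fps_nth (partial_gf r N) m = C m" for m N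
    by (simp add: C_def partial_gf_agree)
  note lim_C = tendsto_suminf_stabilising_coeffs[OF sm_C partial_gf_nonneg le_C eq_C]
  note lim_log = tendsto_suminf_stabilising_coeffs[OF sm_log[unfolded \<rho>_def] partial_log_coeffs]
  have "(\<lambda>N. \<Sum>m. of_real (fps_nth (partial_gf r N) m) * q ^ m) \<longlonglongrightarrow> (\<Sum>m. of_real (C m) * q ^ m)"
    by (rule lim_C(1))
  moreover have "(\<Sum>m. of_real (fps_nth (partial_gf r N) m) * q ^ m) =
      exp (\<Sum>m. of_real (fps_nth (partial_log r N) m) * q ^ m)" for N
    using gf_sums[of q N] by (simp add: \<rho>_def fps_sums_to_def sums_iff)
  moreover have "(\<lambda>N. exp (\<Sum>m. of_real (fps_nth (partial_log r N) m) * q ^ m)) \<longlonglongrightarrow>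
      exp (\<Sum>m. of_real (log_coeff r m) * q ^ m)"
    by (intro tendsto_exp lim_log(1))
  ultimately have "(\<Sum>m. of_real (C m) * q ^ m) = exp (\<Sum>m. of_real (log_coeff r m) * q ^ m)"
    using LIMSEQ_unique by simp
  moreover have "summable (\<lambda>m. norm (of_real (C m) * q ^ m))"
    by (rule lim_C(2))
  ultimately show ?thesis
    unfolding fps_sums_to_def C_def using summable_norm_cancel summable_sums by metis
qed

text \<open>
  Everything is a power series in \<open>q\<^sup>t\<close>, so \<open>t\<close> disappears: \<open>H_gf r t\<close> is \<open>H_gf r 1\<close> composed with
  \<open>X\<^sup>t\<close>, because both have product 1 with the same power of the denominator.
\<close>

lemma C_seq_eq_H_gf_1:
  assumes "t > 0"
  shows "C_seq r t n = fps_nth (H_gf r 1) n"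
proof -
  have t: "fps_nth (fps_X ^ t :: real fps) 0 = 0" using assms by simp
  have pos_1: "(0 :: nat) < 1" by simp
  define D :: "nat \<Rightarrow> real fps" where "D s = qpochhammer_inf (fps_X ^ s) (fps_X ^ s)" for s
  have D: "D t = D 1 oo fps_X ^ t"
  proof (rule fps_ext)
    fix m
    define P :: "real fps" where "P = (\<Prod>i\<le>m. 1 - fps_X ^ 1 * (fps_X ^ 1) ^ i)"
    have "(1 - fps_X ^ 1 * (fps_X ^ 1) ^ i) oo fps_X ^ t = 1 - fps_X ^ t * (fps_X ^ t :: real fps) ^ i" for i
      by (simp only: fps_compose_sub_distrib fps_compose_1 fps_compose_mult_distrib[OF t]
          fps_compose_power[OF t, symmetric] fps_X_fps_compose_startby0[OF t] power_one_right)
    hence "(\<Prod>i\<le>m. 1 - fps_X ^ t * (fps_X ^ t) ^ i) = P oo fps_X ^ t"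
      unfolding P_def fps_compose_prod_distrib[OF t] by simp
    hence "fps_nth (D t) m = fps_nth (P oo fps_X ^ t) m"
      unfolding D_def by (simp only: qpochhammer_inf_fps_nth[OF assms])
    moreover have "fps_nth P (m div t) = fps_nth (D 1) (m div t)"
      unfolding P_def D_def qpochhammer_inf_fps_nth[OF pos_1]
      by (rule partial_prod_nth_stable) auto
    ultimately show "fps_nth (D t) m = fps_nth (D 1 oo fps_X ^ t) m"
      by (simp add: fps_nth_compose_X_power)
  qed
  have "(H_gf r 1 oo fps_X ^ t) * D t ^ r = (H_gf r 1 * D 1 ^ r) oo fps_X ^ t"
    by (simp only: D fps_compose_mult_distrib[OF t] fps_compose_power[OF t])
  also have "\<dots> = 1" using H_gf_mult[OF pos_1, of r] by (simp only: D_def fps_compose_1)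
  finally have inv_1: "(H_gf r 1 oo fps_X ^ t) * D t ^ r = 1" .
  have inv_t: "H_gf r t * D t ^ r = 1" using H_gf_mult[OF assms, of r] by (simp only: D_def)
  have "H_gf r t = H_gf r t * ((H_gf r 1 oo fps_X ^ t) * D t ^ r)"
    by (simp only: inv_1 mult_1_right)
  also have "\<dots> = (H_gf r t * D t ^ r) * (H_gf r 1 oo fps_X ^ t)"
    by (simp only: mult_ac)
  finally have "H_gf r t = H_gf r 1 oo fps_X ^ t"
    by (simp only: inv_t mult_1_left)
  thus ?thesis using assms by (simp add: C_seq_def c_coeff_def fps_nth_compose_X_power)
qed

section \<open>Moments of the logarithmic coefficients near the singularity\<close>

definition log_moment :: "nat \<Rightarrow> nat \<Rightarrow> real \<Rightarrow> real" where
  "log_moment r j s = (\<Sum>m. log_coeff r m * real m ^ j * exp (- (real m * s)))"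

lemma log_coeff_eq_sum_divisors:
  "log_coeff r m = real r * (\<Sum>k\<in>{k \<in> {1..m}. k dvd m}. real k / real m)"
  unfolding log_coeff_def by (subst sum.inter_filter) auto

lemma sum_exp_minus_le:
  fixes u :: real
  assumes "u > 0"
  shows "(\<Sum>k=1..M. exp (- (real k * u))) \<le> 1 / u"
proof -
  define x where "x = exp (- u)"
  have x: "0 < x" "x < 1" using assms by (auto simp: x_def)
  have "(\<Sum>k=1..M. exp (- (real k * u))) = (\<Sum>k=1..M. x ^ k)"
    by (simp add: x_def flip: exp_of_nat_mult)
  also have "\<dots> \<le> x / (1 - x)"
  proof -
    have "(1 - x) * (\<Sum>k=1..M. x ^ k) = x - x ^ Suc M"
    proof (induction M)
      case (Suc M)
      have "(1 - x) * (\<Sum>k=1..Suc M. x ^ k) = (1 - x) * (\<Sum>k=1..M. x ^ k) + (1 - x) * x ^ Suc M"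
        by (simp add: distrib_left)
      thus ?case unfolding Suc.IH by (simp add: left_diff_distrib)
    qed simp
    also have "\<dots> \<le> x" using x by simp
    finally show ?thesis using x by (simp add: pos_le_divide_eq mult.commute)
  qed
  also have "\<dots> = 1 / (exp u - 1)"
    using assms by (simp add: x_def exp_minus field_simps)
  also have "\<dots> \<le> 1 / u"
  proof -
    have "u \<le> exp u - 1" using exp_ge_add_one_self[of u] by linarith
    thus ?thesis using assms by (intro divide_left_mono mult_pos_pos) auto
  qed
  finally show ?thesis .
qed

text \<open>
  Writing \<open>m = k l\<close> turns the sum into \<open>r \<Sum>l. (1 / l) \<Sum>k. exp (- k l s)\<close>. The inner sum is at
  most \<open>1 / (l s)\<close>, and what remains is the convergent series of inverse squares. The
  rearrangement is carried out on finite partial sums, which is enough since all terms are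
  nonnegative.
\<close>

lemma log_moment_0_le:
  fixes s :: real
  assumes "s > 0"
  shows "log_moment r 0 s \<le> real r * (\<Sum>l. 1 / real (Suc l) ^ 2) / s"
proof -
  have sm_sq: "summable (\<lambda>l. 1 / real (Suc l) ^ 2)"
    using inverse_squares_sums by (auto simp: sums_iff add.commute)
  have sm: "summable (\<lambda>m. log_coeff r m * exp (- (real m * s)))"
    using summable_log_coeff[OF assms, of r 0] by simp
  have "(\<Sum>m<M. log_coeff r m * exp (- (real m * s))) \<le> real r * (\<Sum>l. 1 / real (Suc l) ^ 2) / s" for M
  proof -
    define g :: "nat \<times> nat \<Rightarrow> real" where "g = (\<lambda>(k, l). 1 / real l * exp (- (real (k * l) * s)))"
    define S where "S = (SIGMA m:{..<M}. {k \<in> {1..m}. k dvd m})"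
    have fin: "finite S" by (auto simp: S_def)
    have S: "k > 0" "k dvd m" "k \<le> m" "m < M" if "(m, k) \<in> S" for m k using that by (auto simp: S_def)
    have inj: "inj_on (\<lambda>(m, k). (k, m div k)) S"
      proof (rule inj_onI)
        fix p q assume pq: "p \<in> S" "q \<in> S" "(case p of (m, k) \<Rightarrow> (k, m div k)) = (case q of (m, k) \<Rightarrow> (k, m div k))"
        obtain m k m' k' where [simp]: "p = (m, k)" "q = (m', k')" by (cases p, cases q) auto
        from pq have "k' = k" "m div k = m' div k" "k dvd m" "k dvd m'" using S by auto
        thus "p = q" by (simp add: dvd_div_eq_iff)
      qed
    have "(\<Sum>m<M. log_coeff r m * exp (- (real m * s))) =
        real r * (\<Sum>m<M. \<Sum>k\<in>{k \<in> {1..m}. k dvd m}. real k / real m * exp (- (real m * s)))"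
      by (simp only: log_coeff_eq_sum_divisors sum_distrib_left sum_distrib_right mult.assoc)
    also have "(\<Sum>m<M. \<Sum>k\<in>{k \<in> {1..m}. k dvd m}. real k / real m * exp (- (real m * s))) =
        (\<Sum>(m, k)\<in>S. real k / real m * exp (- (real m * s)))"
      unfolding S_def by (rule sum.Sigma) auto
    also have "\<dots> = (\<Sum>p\<in>S. g (case p of (m, k) \<Rightarrow> (k, m div k)))"
    proof (rule sum.cong[OF refl])
      fix p assume "p \<in> S"
      obtain m k where p: "p = (m, k)" by force
      with \<open>p \<in> S\<close> have mk: "k > 0" "k * (m div k) = m" "m > 0" using S[of m k] by auto
      have "real k / real m = 1 / real (m div k)"
        using mk by (metis div_by_1 nonzero_divide_mult_cancel_left of_nat_0_less_iff of_nat_mult order_less_irrefl)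
      thus "(case p of (m, k) \<Rightarrow> real k / real m * exp (- (real m * s))) = g (case p of (m, k) \<Rightarrow> (k, m div k))"
        by (simp only: p g_def prod.case mk)
    qed
    also have "\<dots> = sum g ((\<lambda>(m, k). (k, m div k)) ` S)"
      by (simp add: sum.reindex[OF inj] o_def)
    also have "\<dots> \<le> sum g ({1..M} \<times> {1..M})"
    proof (rule sum_mono2)
      show "(\<lambda>(m, k). (k, m div k)) ` S \<subseteq> {1..M} \<times> {1..M}"
      proof safe
        fix m k assume "(m, k) \<in> S"
        note mk = S[OF this]
        have "m div k \<le> M" using div_le_dividend[of m k] mk by linarith
        with mk show "k \<in> {1..M}" "m div k \<in> {1..M}"
          using div_greater_zero_iff[of m k] by (auto simp: Suc_le_eq)
      qed
    qed (auto simp: g_def)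
    also have "\<dots> = (\<Sum>l=1..M. 1 / real l * (\<Sum>k=1..M. exp (- (real k * (real l * s)))))"
      unfolding g_def by (subst sum.cartesian_product[symmetric], subst sum.swap) (simp add: sum_distrib_left mult.assoc)
    also have "\<dots> \<le> (\<Sum>l=1..M. 1 / real l * (1 / (real l * s)))"
      by (intro sum_mono mult_left_mono sum_exp_minus_le) (use assms in auto)
    also have "\<dots> = (\<Sum>l<M. 1 / real (Suc l) ^ 2) / s"
      unfolding sum_divide_distrib
      by (rule sum.reindex_bij_witness[of _ Suc "\<lambda>l. l - 1"]) (auto simp: power2_eq_square)
    also have "\<dots> \<le> (\<Sum>l. 1 / real (Suc l) ^ 2) / s"
      by (intro divide_right_mono sum_le_suminf sm_sq) (use assms in auto)
    finally show ?thesis by (simp add: mult_left_mono)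
  qed
  thus ?thesis unfolding log_moment_def using sm by (intro suminf_le_const) auto
qed

lemma log_moment_le:
  "\<exists>K>0. \<forall>s>0. log_moment r j s \<le> K / s ^ (j + 1)"
proof -
  define Z where "Z = (\<Sum>l. 1 / real (Suc l) ^ 2)"
  have "Z \<ge> 0" unfolding Z_def using inverse_squares_sums by (intro suminf_nonneg) (auto simp: sums_iff add.commute)
  define K where "K = fact j * 2 ^ (j + 1) * (real r * Z) + 1"
  have "K > 0" using \<open>Z \<ge> 0\<close> by (auto simp: K_def intro!: add_nonneg_pos)
  moreover have "log_moment r j s \<le> K / s ^ (j + 1)" if "s > 0" for s
  proof -
    have "log_moment r j s \<le> (\<Sum>m. fact j * (2 / s) ^ j * (log_coeff r m * real m ^ 0 * exp (- (real m * (s / 2)))))"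
      unfolding log_moment_def
    proof (rule suminf_le)
      show "log_coeff r m * real m ^ j * exp (- (real m * s)) \<le>
          fact j * (2 / s) ^ j * (log_coeff r m * real m ^ 0 * exp (- (real m * (s / 2))))" for m
        using mult_left_mono[OF power_times_exp_minus_le[OF that, of m j] log_coeff_nonneg[of r m]]
        by (simp add: mult_ac)
    qed (intro summable_mult summable_log_coeff; use that in simp)+
    also have "\<dots> = fact j * (2 / s) ^ j * log_moment r 0 (s / 2)"
      unfolding log_moment_def by (rule suminf_mult) (use summable_log_coeff[of "s / 2" r 0] that in simp)
    also have "\<dots> \<le> fact j * (2 / s) ^ j * (real r * Z / (s / 2))"
      unfolding Z_def by (intro mult_left_mono log_moment_0_le) (use that in auto)
    also have "\<dots> = fact j * 2 ^ (j + 1) * (real r * Z) / s ^ (j + 1)"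
      using that by (simp add: power_divide field_simps)
    also have "\<dots> \<le> K / s ^ (j + 1)"
      by (intro divide_right_mono) (use that in \<open>auto simp: K_def\<close>)
    finally show ?thesis .
  qed
  ultimately show ?thesis by blast
qed

text \<open>
  The indices between \<open>N\<close> and \<open>2 N\<close> with \<open>N\<close> about \<open>1 / s\<close> suffice: there are \<open>N\<close> of them, each
  contributes at least \<open>N\<^sup>2\<close> times the value of the exponential, and \<open>m s\<close> stays at most 4.
\<close>

lemma log_moment_2_ge:
  assumes "r > 0" "0 < s" "s \<le> 1"
  shows "log_moment r 2 s \<ge> exp (- 4) / s ^ 3"
proof -
  define N where "N = nat \<lceil>1 / s\<rceil>"
  have N: "1 / s \<le> real N" "real N \<le> 2 / s"
  proof -
    show "1 / s \<le> real N" unfolding N_def by linarith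
    have "real N < 1 / s + 1" unfolding N_def using assms by (auto simp: ceiling_less_iff) linarith
    also have "1 \<le> 1 / s" using assms by simp
    hence "1 / s + 1 \<le> 2 / s" by simp
    finally show "real N \<le> 2 / s" by simp
  qed
  have Ns: "real N * s \<le> 2" using N(2) assms by (simp add: field_simps)
  have "exp (- 4) / s ^ 3 = (1 / s) ^ 3 * exp (- 4)" by (simp add: power_divide)
  also have "\<dots> \<le> real N ^ 3 * exp (- 4)"
    by (intro mult_right_mono power_mono N) (use assms in auto)
  also have "\<dots> = (\<Sum>m\<in>{N<..2 * N}. 1 * real N ^ 2 * exp (- 4))"
    by (simp add: power3_eq_cube power2_eq_square)
  also have "\<dots> \<le> (\<Sum>m\<in>{N<..2 * N}. log_coeff r m * real m ^ 2 * exp (- (real m * s)))"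
  proof (intro sum_mono mult_mono power_mono)
    fix m assume m: "m \<in> {N<..2 * N}"
    show "1 \<le> log_coeff r m" using assms m by (intro log_coeff_ge_1) auto
    have "real m * s \<le> 2 * (real N * s)" using m assms by auto
    thus "exp (- 4) \<le> exp (- (real m * s))" using Ns by simp
  qed (auto intro!: mult_nonneg_nonneg log_coeff_nonneg)
  also have "\<dots> \<le> log_moment r 2 s"
    unfolding log_moment_def
    by (intro sum_le_suminf summable_log_coeff) (use assms in \<open>auto intro!: mult_nonneg_nonneg log_coeff_nonneg\<close>)
  finally show ?thesis .
qed

lemma isCont_log_moment:
  assumes "s > 0" shows "isCont (log_moment r j) s"
proof -
  define f where "f x = (\<Sum>m. (log_coeff r m * real m ^ j) * x ^ m)" for x :: real
  have "summable (\<lambda>m. (log_coeff r m * real m ^ j) * exp (- (s / 2)) ^ m)"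
    using summable_log_coeff[of "s / 2" r j] assms by (simp add: exp_of_nat_mult[symmetric])
  hence "isCont f (exp (- s))"
    unfolding f_def by (rule isCont_powser) (use assms in auto)
  hence "isCont (\<lambda>s. f (exp (- s))) s"
    by (rule isCont_o2[rotated]) simp
  moreover have "f (exp (- s)) = log_moment r j s" for s
    by (simp add: f_def log_moment_def flip: exp_of_nat_mult)
  ultimately show ?thesis by simp
qed

text \<open>
  Existence of the saddle point of \<open>exp (n s) * exp (log_moment r 0 s)\<close>, where the logarithmic
  derivative vanishes, by the intermediate value theorem: the first moment is small for large \<open>s\<close>,
  and large for small \<open>s\<close>.
\<close>

lemma saddle_exists:
  assumes "r > 0" "n > 0"
  shows "\<exists>s>0. log_moment r 1 s = real n"
proof -
  obtain K where K: "K > 0" "\<And>s. s > 0 \<Longrightarrow> log_moment r 1 s \<le> K / s ^ 2"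
    using log_moment_le[of r 1] by (auto simp: power2_eq_square)
  \<comment> \<open>The lower end is chosen so that the single term with index \<open>2 n\<close> is already at least \<open>n\<close>.\<close>
  define a where "a = ln 2 / (2 * real n)"
  define b where "b = sqrt K + 1"
  have "a > 0" using assms by (simp add: a_def)
  have "b \<ge> 1" using K by (simp add: b_def)
  have "ln 2 \<le> (1 :: real)" using ln_2_less_1 by simp
  hence "a \<le> 1" using assms by (auto simp: a_def divide_le_eq)
  have "log_moment r 1 b \<le> real n"
  proof -
    have "K \<le> b ^ 2" using K by (simp add: b_def power2_sum)
    hence "K / b ^ 2 \<le> 1" using \<open>b \<ge> 1\<close> by (simp add: divide_le_eq)
    moreover have "log_moment r 1 b \<le> K / b ^ 2" by (rule K(2)) (use \<open>b \<ge> 1\<close> in simp)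
    moreover have "1 \<le> real n" using assms(2) by simp
    ultimately show ?thesis by linarith
  qed
  moreover have "real n \<le> log_moment r 1 a"
  proof -
    have "exp (- (real (2 * n) * a)) = 1 / 2"
      using assms by (simp add: a_def exp_minus)
    hence "real n = 1 * real (2 * n) ^ 1 * exp (- (real (2 * n) * a))" by simp
    also have "\<dots> \<le> log_coeff r (2 * n) * real (2 * n) ^ 1 * exp (- (real (2 * n) * a))"
      by (intro mult_right_mono log_coeff_ge_1) (use assms in auto)
    also have "\<dots> = (\<Sum>m\<in>{2 * n}. log_coeff r m * real m ^ 1 * exp (- (real m * a)))" by simp
    also have "\<dots> \<le> log_moment r 1 a"
      unfolding log_moment_def using \<open>a > 0\<close>
      by (intro sum_le_suminf summable_log_coeff) (auto intro!: mult_nonneg_nonneg log_coeff_nonneg)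
    finally show ?thesis .
  qed
  ultimately have "\<exists>s\<ge>a. s \<le> b \<and> log_moment r 1 s = real n"
    by (intro IVT2') (use \<open>a \<le> 1\<close> \<open>b \<ge> 1\<close> \<open>a > 0\<close> in \<open>auto intro!: continuous_at_imp_continuous_on isCont_log_moment\<close>)
  thus ?thesis using \<open>a > 0\<close> by (meson less_le_trans)
qed

section \<open>Decay of the generating function away from the positive axis\<close>

lemma pi_le_63_20: "pi \<le> 63 / 20"
  using pi_approx(2) by simp

lemma one_minus_cos_ge:
  fixes x :: real
  assumes "\<bar>x\<bar> \<le> pi" shows "1 - cos x \<ge> x ^ 2 / 12"
proof -
  obtain t where "cos x = (\<Sum>m<4. cos_coeff m * x ^ m) + cos (t + 1 / 2 * real 4 * pi) / fact 4 * x ^ 4"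
    using Maclaurin_cos_expansion[of x 4] by blast
  hence "cos x = 1 - x ^ 2 / 2 + cos (t + 2 * pi) / 24 * x ^ 4"
    by (simp add: cos_coeff_def lessThan_nat_numeral fact_numeral)
  also have "\<dots> \<le> 1 - x ^ 2 / 2 + 1 / 24 * x ^ 4"
    by (intro add_mono mult_right_mono divide_right_mono) auto
  finally have cos: "cos x \<le> 1 - x ^ 2 / 2 + x ^ 2 * x ^ 2 / 24" by (simp add: power2_eq_square eval_nat_numeral)
  have "\<bar>x\<bar> \<le> 63 / 20" using assms pi_le_63_20 by linarith
  hence "\<bar>x\<bar> ^ 2 \<le> (63 / 20) ^ 2" by (intro power_mono) auto
  hence "x ^ 2 \<le> 10" by (simp add: power2_eq_square)
  hence "x ^ 2 * x ^ 2 \<le> 10 * x ^ 2" by (intro mult_right_mono) auto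
  with cos show ?thesis by linarith
qed

text \<open>
  The real part of a geometric series at \<open>\<rho> cis \<theta>\<close>, subtracted from its value at \<open>\<rho>\<close>.
\<close>

lemma sums_exp_minus_one_minus_cos:
  fixes s \<theta> :: real
  assumes "s > 0"
  defines "\<rho> \<equiv> exp (- s)"
  shows "(\<lambda>m. exp (- (real m * s)) * (1 - cos (real m * \<theta>))) sums
           (\<rho> * (1 + \<rho>) * (1 - cos \<theta>) / ((1 - \<rho>) * ((1 - \<rho>) ^ 2 + 2 * \<rho> * (1 - cos \<theta>))))"
proof -
  have \<rho>: "0 < \<rho>" "\<rho> < 1" using assms by auto
  define w where "w = of_real \<rho> * cis \<theta>"
  have w: "norm w < 1" using \<rho> by (simp add: w_def norm_mult)
  have "(\<lambda>m. Re (w ^ m)) sums Re (1 / (1 - w))" by (intro sums_Re geometric_sums w)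
  moreover have "Re (w ^ m) = exp (- (real m * s)) * cos (real m * \<theta>)" for m
  proof -
    have "w ^ m = of_real (\<rho> ^ m) * cis (real m * \<theta>)"
      by (simp only: w_def power_mult_distrib Complex.DeMoivre of_real_power)
    thus ?thesis by (simp add: \<rho>_def flip: exp_of_nat_mult)
  qed
  moreover have "(\<lambda>m. \<rho> ^ m) sums (1 / (1 - \<rho>))" using \<rho> by (intro geometric_sums) auto
  moreover have "\<rho> ^ m = exp (- (real m * s))" for m by (simp add: \<rho>_def flip: exp_of_nat_mult)
  ultimately have "(\<lambda>m. exp (- (real m * s)) * (1 - cos (real m * \<theta>))) sums (1 / (1 - \<rho>) - Re (1 / (1 - w)))"
    using sums_diff[of "\<lambda>m. exp (- (real m * s))"] by (simp add: algebra_simps)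
  moreover have "1 / (1 - \<rho>) - Re (1 / (1 - w)) = \<rho> * (1 + \<rho>) * (1 - cos \<theta>) / ((1 - \<rho>) * ((1 - \<rho>) ^ 2 + 2 * \<rho> * (1 - cos \<theta>)))"
  proof -
    define D where "D = (1 - \<rho>) ^ 2 + 2 * \<rho> * (1 - cos \<theta>)"
    have "D > 0" unfolding D_def using \<rho> by (intro add_pos_nonneg mult_nonneg_nonneg) auto
    have expand: "(1 - \<rho> * a) ^ 2 + (\<rho> * b) ^ 2 = 1 - 2 * \<rho> * a + \<rho> ^ 2 * (a ^ 2 + b ^ 2)" for a b
      by (simp add: power2_eq_square algebra_simps)
    have "(1 - \<rho> * cos \<theta>) ^ 2 + (\<rho> * sin \<theta>) ^ 2 = 1 - 2 * \<rho> * cos \<theta> + \<rho> ^ 2 * ((cos \<theta>) ^ 2 + (sin \<theta>) ^ 2)"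
      by (rule expand)
    also have "\<dots> = D"
      unfolding sin_cos_squared_add2 by (simp add: D_def power2_eq_square algebra_simps)
    finally have R: "Re (1 / (1 - w)) = (1 - \<rho> * cos \<theta>) / D"
      by (simp add: Re_divide w_def)
    show ?thesis unfolding R D_def[symmetric] using \<open>D > 0\<close> \<rho>
      by (simp add: divide_simps) (simp add: D_def power2_eq_square algebra_simps)
  qed
  ultimately show ?thesis by simp
qed

lemma summable_log_coeff_one_minus_cos:
  fixes s \<theta> :: real
  assumes "s > 0"
  shows "summable (\<lambda>m. log_coeff r m * exp (- (real m * s)) * (1 - cos (real m * \<theta>)))"
proof (rule summable_comparison_test')
  show "summable (\<lambda>m. 2 * (log_coeff r m * real m ^ 0 * exp (- (real m * s))))"
    by (intro summable_mult summable_log_coeff assms)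
  fix m
  have "\<bar>1 - cos (real m * \<theta>)\<bar> \<le> 2" using cos_ge_minus_one[of "real m * \<theta>"] cos_le_one[of "real m * \<theta>"] by simp
  from mult_left_mono[OF this, of "log_coeff r m * exp (- (real m * s))"] log_coeff_nonneg[of r m]
  show "norm (log_coeff r m * exp (- (real m * s)) * (1 - cos (real m * \<theta>))) \<le> 2 * (log_coeff r m * real m ^ 0 * exp (- (real m * s)))"
    by (simp add: abs_mult mult_ac)
qed

text \<open>
  Since the coefficients with positive index are at least 1, the sum dominates the geometric sum
  with all coefficients equal to 1, which has a closed form. The closed form increases with
  \<open>1 - cos \<theta>\<close>, which is at least \<open>\<theta>\<^sup>2 / 12\<close>. The resulting bound is of order \<open>\<theta>\<^sup>2 / s\<^sup>3\<close> for
  \<open>\<theta>\<close> below \<open>s\<close> and of order \<open>1 / s\<close> beyond.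
\<close>

lemma real_exponent_ge:
  fixes s \<theta> :: real
  assumes "r > 0" "0 < s" "s \<le> 1" "\<bar>\<theta>\<bar> \<le> pi"
  shows "(\<Sum>m. log_coeff r m * exp (- (real m * s)) * (1 - cos (real m * \<theta>))) \<ge>
           exp (- 1) / 12 * \<theta> ^ 2 / (s * (s ^ 2 + \<theta> ^ 2))"
proof -
  define \<rho> where "\<rho> = exp (- s)"
  define v where "v = 1 - cos \<theta>"
  have \<rho>: "\<rho> < 1" "exp (- 1) \<le> \<rho>" "1 - \<rho> \<le> s" "0 < \<rho>"
    using assms exp_ge_add_one_self[of "- s"] by (auto simp: \<rho>_def)
  have v: "v \<ge> \<theta> ^ 2 / 12" using one_minus_cos_ge[OF assms(4)] by (simp add: v_def)
  hence "v \<ge> 0" by (meson order_trans zero_le_divide_iff zero_le_power2 zero_le_numeral)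
  note L = sums_exp_minus_one_minus_cos[OF assms(2), of \<theta>, folded \<rho>_def v_def]
  note sm = summable_log_coeff_one_minus_cos[OF assms(2), of r \<theta>]
  have "exp (- 1) / 12 * \<theta> ^ 2 / (s * (s ^ 2 + \<theta> ^ 2)) \<le> exp (- 1) * (v / (s * (s ^ 2 + 2 * v)))"
  proof -
    have "\<theta> ^ 2 / 12 / (s ^ 2 + \<theta> ^ 2) \<le> v / (s ^ 2 + 2 * v)"
    proof -
      have "\<theta> ^ 2 * (s ^ 2 + 2 * v) \<le> 12 * v * (s ^ 2 + \<theta> ^ 2)"
      proof -
        have "\<theta> ^ 2 * (s ^ 2 + 2 * v) = \<theta> ^ 2 * s ^ 2 + 2 * (v * \<theta> ^ 2)" by (simp add: algebra_simps)
        also have "\<dots> \<le> 12 * v * s ^ 2 + 12 * (v * \<theta> ^ 2)"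
          using v \<open>v \<ge> 0\<close> by (intro add_mono mult_right_mono) auto
        finally show ?thesis by (simp add: algebra_simps)
      qed
      thus ?thesis using assms \<open>v \<ge> 0\<close>
        by (simp add: divide_simps add_pos_nonneg mult_ac zero_less_mult_iff)
    qed
    from mult_left_mono[OF this, of "exp (- 1) / s"] assms show ?thesis by (simp add: mult_ac)
  qed
  also have "\<dots> \<le> \<rho> * (1 + \<rho>) * v / ((1 - \<rho>) * ((1 - \<rho>) ^ 2 + 2 * \<rho> * v))"
  proof -
    have "(1 - \<rho>) * ((1 - \<rho>) ^ 2 + 2 * \<rho> * v) \<le> s * (s ^ 2 + 2 * v)"
      using \<rho> \<open>v \<ge> 0\<close> assms
      by (intro mult_mono add_mono power_mono) (auto simp: mult_left_le_one_le mult_right_mono)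
    moreover have "exp (- 1) * v \<le> \<rho> * (1 + \<rho>) * v"
      using mult_mono[of "exp (- 1)" \<rho> 1 "1 + \<rho>"] \<rho> \<open>v \<ge> 0\<close> by (intro mult_right_mono) auto
    moreover have "0 < (1 - \<rho>) * ((1 - \<rho>) ^ 2 + 2 * \<rho> * v)"
      using \<rho> \<open>v \<ge> 0\<close> by (intro mult_pos_pos add_pos_nonneg) auto
    ultimately have "exp (- 1) * v / (s * (s ^ 2 + 2 * v)) \<le> \<rho> * (1 + \<rho>) * v / ((1 - \<rho>) * ((1 - \<rho>) ^ 2 + 2 * \<rho> * v))"
      using \<rho> \<open>v \<ge> 0\<close> by (intro frac_le) auto
    thus ?thesis by simp
  qed
  also have "\<dots> = (\<Sum>m. exp (- (real m * s)) * (1 - cos (real m * \<theta>)))" using L by (simp add: sums_iff)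
  also have "\<dots> \<le> (\<Sum>m. log_coeff r m * exp (- (real m * s)) * (1 - cos (real m * \<theta>)))"
  proof (rule suminf_le)
    fix m
    show "exp (- (real m * s)) * (1 - cos (real m * \<theta>)) \<le> log_coeff r m * exp (- (real m * s)) * (1 - cos (real m * \<theta>))"
      using mult_right_mono[of 1 "log_coeff r m" "exp (- (real m * s)) * (1 - cos (real m * \<theta>))"] log_coeff_ge_1[OF assms(1), of m]
      by (cases "m = 0") (auto simp: mult.assoc)
  qed (use L sm in \<open>auto simp: sums_iff\<close>)
  finally show ?thesis .
qed

text \<open>
  In the variable \<open>u = \<sigma> \<theta>\<close>, where \<open>\<sigma>\<close> is the root of the second moment and is of order \<open>s powr (-3/2)\<close>,
  the previous bound is at least a constant multiple of \<open>u\<^sup>2\<close> near 0 but only of order \<open>1 / s\<close> at the ends of the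
  circle, where \<open>|u|\<close> is of order \<open>s powr (-3/2)\<close>. The bound that holds throughout, with a constant
  independent of \<open>s\<close>, is thus of order \<open>|u| powr (2/3)\<close>; it is stated for cubes to
  avoid fractional powers.
\<close>

lemma rescaled_exponent_ge:
  assumes "r > 0"
  shows "\<exists>\<kappa>>0. \<forall>s u. 0 < s \<longrightarrow> s \<le> 1 \<longrightarrow> 1 \<le> \<bar>u\<bar> \<longrightarrow> \<bar>u\<bar> \<le> pi * sqrt (log_moment r 2 s) \<longrightarrow>
     \<kappa> * u ^ 2 \<le> (\<Sum>m. log_coeff r m * exp (- (real m * s)) * (1 - cos (real m * (u / sqrt (log_moment r 2 s))))) ^ 3"
proof -
  obtain K where K: "K > 0" "\<And>s. s > 0 \<Longrightarrow> log_moment r 2 s \<le> K / s ^ 3"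
    using log_moment_le[of r 2] by (auto simp: eval_nat_numeral)
  define c :: real where "c = exp (- 1) / 12"
  define M where "M = 4 * (K ^ 3 + 10 * K)"
  have "c > 0" by (simp add: c_def)
  have "M > 0" using K by (auto simp: M_def intro!: add_pos_pos)
  have "c ^ 3 / M * u ^ 2 \<le> (\<Sum>m. log_coeff r m * exp (- (real m * s)) * (1 - cos (real m * (u / sqrt (log_moment r 2 s))))) ^ 3"
    if s: "0 < s" "s \<le> 1" and u: "1 \<le> \<bar>u\<bar>" "\<bar>u\<bar> \<le> pi * sqrt (log_moment r 2 s)" for s u
  proof -
    define V where "V = log_moment r 2 s"
    define \<theta> where "\<theta> = u / sqrt V"
    have "0 < exp (- 4) / s ^ 3" using s by simp
    also have "\<dots> \<le> V" unfolding V_def by (rule log_moment_2_ge[OF assms s])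
    finally have "V > 0" .
    have V: "s ^ 3 * V \<le> K" using K(2)[OF s(1)] s by (simp add: V_def field_simps)
    have \<theta>: "\<bar>\<theta>\<bar> \<le> pi" using u \<open>V > 0\<close> by (simp add: \<theta>_def V_def[symmetric] abs_divide field_simps)
    have \<theta>2: "\<theta> ^ 2 = u ^ 2 / V" using \<open>V > 0\<close> by (simp add: \<theta>_def power_divide)
    \<comment> \<open>The bound on \<open>|u|\<close> makes \<open>s ^ 3 * u ^ 2\<close> bounded, so \<open>D ^ 3\<close> grows like \<open>u ^ 4\<close> only.\<close>
    define D where "D = K + s * u ^ 2"
    have "D > 0" unfolding D_def using K s by (intro add_pos_nonneg) auto
    have "u ^ 2 \<ge> 1" using u(1) by (simp add: abs_le_square_iff[of 1 u, simplified])
    have "c * u ^ 2 / D \<le> c * u ^ 2 / (s ^ 3 * V + s * u ^ 2)"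
      using V s K(1) \<open>V > 0\<close> \<open>c > 0\<close> \<open>D > 0\<close> unfolding D_def
      by (intro divide_left_mono mult_pos_pos add_pos_nonneg) auto
    also have "\<dots> = c * \<theta> ^ 2 / (s * (s ^ 2 + \<theta> ^ 2))"
      unfolding \<theta>2 using \<open>V > 0\<close> s by (simp add: field_simps power3_eq_cube power2_eq_square)
    also have "\<dots> \<le> (\<Sum>m. log_coeff r m * exp (- (real m * s)) * (1 - cos (real m * \<theta>)))"
      unfolding c_def by (rule real_exponent_ge[OF assms s \<theta>])
    finally have "(c * u ^ 2 / D) ^ 3 \<le> (\<Sum>m. log_coeff r m * exp (- (real m * s)) * (1 - cos (real m * \<theta>))) ^ 3"
      using \<open>c > 0\<close> \<open>D > 0\<close> by (intro power_mono) auto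
    moreover have "c ^ 3 / M * u ^ 2 \<le> (c * u ^ 2 / D) ^ 3"
    proof -
      have "u ^ 2 \<le> pi ^ 2 * V"
        using power_mono[OF u(2), of 2] \<open>V > 0\<close> by (simp add: power_mult_distrib V_def)
      hence "s ^ 3 * u ^ 2 \<le> s ^ 3 * (pi ^ 2 * V)" using s by (intro mult_left_mono) auto
      also have "\<dots> = pi ^ 2 * (s ^ 3 * V)" by simp
      also have "\<dots> \<le> 10 * K"
      proof (intro mult_mono V)
        have "pi ^ 2 \<le> (63 / 20) ^ 2" using pi_le_63_20 pi_gt_zero by (intro power_mono) auto
        also have "\<dots> \<le> (10 :: real)" by (simp add: power2_eq_square)
        finally show "pi ^ 2 \<le> 10" .
      qed (use s \<open>V > 0\<close> in auto)
      finally have su: "s ^ 3 * u ^ 2 \<le> 10 * K" .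
      have cube: "(a + b) ^ 3 \<le> 4 * (a ^ 3 + b ^ 3)" if "a \<ge> 0" "b \<ge> 0" for a b :: real
      proof -
        have "4 * (a ^ 3 + b ^ 3) - (a + b) ^ 3 = 3 * (a + b) * (a - b) ^ 2"
          by (simp add: power3_eq_cube power2_eq_square algebra_simps)
        moreover have "0 \<le> 3 * (a + b) * (a - b) ^ 2" using that by simp
        ultimately show ?thesis by linarith
      qed
      have "D ^ 3 \<le> 4 * (K ^ 3 + (s * u ^ 2) ^ 3)"
        unfolding D_def using K s by (intro cube) auto
      also have "(s * u ^ 2) ^ 3 = (s ^ 3 * u ^ 2) * (u ^ 2) ^ 2"
        by (simp add: power_mult_distrib flip: power_mult power_add)
      also have "\<dots> \<le> 10 * K * (u ^ 2) ^ 2" using su by (intro mult_right_mono) auto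
      also have "K ^ 3 \<le> K ^ 3 * (u ^ 2) ^ 2"
        using K one_le_power[OF \<open>u ^ 2 \<ge> 1\<close>, of 2] by simp
      finally have "D ^ 3 \<le> M * (u ^ 2) ^ 2" by (simp add: M_def algebra_simps)
      hence "c ^ 3 * (u ^ 2) ^ 3 / (M * (u ^ 2) ^ 2) \<le> c ^ 3 * (u ^ 2) ^ 3 / D ^ 3"
        using \<open>c > 0\<close> \<open>D > 0\<close> \<open>M > 0\<close> \<open>u ^ 2 \<ge> 1\<close> by (intro divide_left_mono mult_pos_pos) auto
      moreover have "c ^ 3 * (u ^ 2) ^ 3 / (M * (u ^ 2) ^ 2) = c ^ 3 / M * u ^ 2"
        using \<open>M > 0\<close> \<open>u ^ 2 \<ge> 1\<close> by (auto simp: field_simps power3_eq_cube power2_eq_square)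
      ultimately show ?thesis by (simp add: power_divide power_mult_distrib)
    qed
    ultimately show ?thesis by (simp add: \<theta>_def V_def)
  qed
  moreover have "c ^ 3 / M > 0" using \<open>c > 0\<close> \<open>M > 0\<close> by simp
  ultimately show ?thesis by blast
qed

section \<open>Coefficients as Fourier integrals\<close>

text \<open>
  The exponential of this sum is the quotient of the values of the generating function at
  \<open>exp (- s - i \<theta>)\<close> and at \<open>exp (- s)\<close>.
\<close>

definition char_exponent :: "nat \<Rightarrow> real \<Rightarrow> real \<Rightarrow> complex" where
  "char_exponent r s \<theta> = (\<Sum>m. of_real (log_coeff r m * exp (- (real m * s))) * (cis (- (real m * \<theta>)) - 1))"

lemma norm_cis_minus_1_le: "norm (cis x - 1) \<le> 2"
  by (rule order_trans[OF norm_triangle_ineq4]) simp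

lemma summable_log_coeff_exp:
  assumes "s > 0"
  shows "summable (\<lambda>m. log_coeff r m * exp (- (real m * s)))"
  using summable_log_coeff[OF assms, of r 0] by simp

lemma summable_bounded_log_coeff:
  fixes f :: "nat \<Rightarrow> complex"
  assumes "s > 0" "\<And>m. norm (f m) \<le> B"
  shows "summable (\<lambda>m. of_real (log_coeff r m * exp (- (real m * s))) * f m)"
proof (rule summable_comparison_test')
  show "summable (\<lambda>m. log_coeff r m * exp (- (real m * s)) * B)"
    by (intro summable_mult2 summable_log_coeff_exp assms)
  show "norm (of_real (log_coeff r m * exp (- (real m * s))) * f m) \<le> log_coeff r m * exp (- (real m * s)) * B" for m
    using mult_left_mono[OF assms(2)[of m], of "log_coeff r m * exp (- (real m * s))"] log_coeff_nonneg[of r m]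
    by (simp add: norm_mult)
qed

lemma Re_char_exponent:
  assumes "s > 0"
  shows "Re (char_exponent r s \<theta>) = - (\<Sum>m. log_coeff r m * exp (- (real m * s)) * (1 - cos (real m * \<theta>)))"
proof -
  have sm: "summable (\<lambda>m. of_real (log_coeff r m * exp (- (real m * s))) * (cis (- (real m * \<theta>)) - 1))"
    by (rule summable_bounded_log_coeff[OF assms norm_cis_minus_1_le])
  have "Re (char_exponent r s \<theta>) = (\<Sum>m. Re (of_real (log_coeff r m * exp (- (real m * s))) * (cis (- (real m * \<theta>)) - 1)))"
    unfolding char_exponent_def by (rule Re_suminf[OF sm])
  also have "\<dots> = (\<Sum>m. - (log_coeff r m * exp (- (real m * s)) * (1 - cos (real m * \<theta>))))"
    by (simp add: algebra_simps)
  also have "\<dots> = - (\<Sum>m. log_coeff r m * exp (- (real m * s)) * (1 - cos (real m * \<theta>)))"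
    by (intro suminf_minus summable_log_coeff_one_minus_cos assms)
  finally show ?thesis .
qed

lemma Re_char_exponent_nonpos:
  assumes "s > 0" shows "Re (char_exponent r s \<theta>) \<le> 0"
proof -
  have "0 \<le> (\<Sum>m. log_coeff r m * exp (- (real m * s)) * (1 - cos (real m * \<theta>)))"
    by (intro suminf_nonneg summable_log_coeff_one_minus_cos assms mult_nonneg_nonneg log_coeff_nonneg) auto
  thus ?thesis by (simp add: Re_char_exponent[OF assms])
qed

lemma measurable_char_exponent [measurable]: "char_exponent r s \<in> borel_measurable borel"
proof -
  have [measurable]: "cis \<in> borel_measurable borel"
    by (intro borel_measurable_continuous_onI continuous_intros)
  show ?thesis unfolding char_exponent_def[abs_def] by measurable
qed

lemma gf_on_circle_sums:
  assumes "s > 0"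
  shows "(\<lambda>m. of_real (fps_nth (H_gf r 1) m * exp (- (real m * s))) * cis (- (real m * \<theta>))) sums
           (of_real (exp (log_moment r 0 s)) * exp (char_exponent r s \<theta>))"
    and "summable (\<lambda>m. \<bar>fps_nth (H_gf r 1) m\<bar> * exp (- (real m * s)))"
proof -
  define q where "q = of_real (exp (- s)) * cis (- \<theta>)"
  have "norm q < 1" using assms by (simp add: q_def norm_mult)
  note * = H_gf_sums_to_exp[OF this, of r]
  have q: "q ^ m = of_real (exp (- (real m * s))) * cis (- (real m * \<theta>))" for m
    by (simp only: q_def power_mult_distrib Complex.DeMoivre exp_of_nat_mult[symmetric]
        of_real_power[symmetric] mult_minus_right)
  have "(\<Sum>m. of_real (log_coeff r m) * q ^ m) =
      (\<Sum>m. of_real (log_coeff r m * exp (- (real m * s))) * (cis (- (real m * \<theta>)) - 1)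
         + of_real (log_coeff r m * exp (- (real m * s))))"
    unfolding q by (simp add: algebra_simps)
  also have "\<dots> = char_exponent r s \<theta> + (\<Sum>m. of_real (log_coeff r m * exp (- (real m * s))))"
    unfolding char_exponent_def
    by (intro suminf_add[symmetric] summable_bounded_log_coeff[OF assms norm_cis_minus_1_le]
        summable_of_real summable_log_coeff_exp assms)
  also have "(\<Sum>m. of_real (log_coeff r m * exp (- (real m * s)))) = complex_of_real (log_moment r 0 s)"
    unfolding log_moment_def by (subst suminf_of_real) (simp_all add: summable_log_coeff_exp assms)
  finally have "exp (\<Sum>m. of_real (log_coeff r m) * q ^ m) = of_real (exp (log_moment r 0 s)) * exp (char_exponent r s \<theta>)"
    by (simp add: exp_add exp_of_real mult.commute)
  with * show "(\<lambda>m. of_real (fps_nth (H_gf r 1) m * exp (- (real m * s))) * cis (- (real m * \<theta>))) sums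
           (of_real (exp (log_moment r 0 s)) * exp (char_exponent r s \<theta>))"
    by (simp add: fps_sums_to_def q mult.assoc)
  show "summable (\<lambda>m. \<bar>fps_nth (H_gf r 1) m\<bar> * exp (- (real m * s)))"
    using * by (simp add: fps_sums_to_def q norm_mult)
qed

lemma integral_cis_period:
  fixes k :: int
  shows "(LINT \<theta>:{-pi..pi}|lborel. cis (of_int k * \<theta>)) = (if k = 0 then of_real (2 * pi) else 0)"
proof (cases "k = 0")
  case True
  thus ?thesis by (simp add: set_lebesgue_integral_def scaleR_conv_of_real)
next
  case False
  define w where "w = \<i> * of_int k"
  have "w \<noteq> 0" using False by (simp add: w_def)
  have cis: "cis (of_int k * \<theta>) = exp (w * of_real \<theta>)" for \<theta>
    by (simp add: w_def cis_conv_exp mult_ac)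
  define F where "F z = exp (w * z) / w" for z
  have "(LINT \<theta>:{-pi..pi}|lborel. cis (of_int k * \<theta>)) = F (of_real pi) - F (of_real (- pi))"
    unfolding set_lebesgue_integral_def
  proof (rule integral_FTC_Icc)
    fix x :: real
    have "(F has_field_derivative exp (w * of_real x)) (at (of_real x))"
      unfolding F_def using \<open>w \<noteq> 0\<close> by (auto intro!: derivative_eq_intros)
    thus "((\<lambda>x. F (of_real x)) has_vector_derivative cis (of_int k * x)) (at x within {-pi..pi})"
      unfolding cis by (rule has_vector_derivative_real_field)
  qed (auto intro!: continuous_intros)
  also have "\<dots> = 0"
  proof -
    have "sin (of_int k * pi) = 0" by (subst sin_zero_iff_int2) blast
    hence "cis (of_int k * pi) = cis (of_int k * (- pi))" by (simp add: complex_eq_iff)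
    thus ?thesis unfolding F_def cis[symmetric] by (simp only: diff_self)
  qed
  finally show ?thesis using False by simp
qed

text \<open>
  Cauchy's formula on the circle of radius \<open>exp (- s)\<close>, obtained by integrating the absolutely
  convergent power series termwise.
\<close>

lemma fourier_coefficient:
  assumes s: "s > 0"
  shows "of_real (fps_nth (H_gf r 1) N * exp (- (real N * s)) * (2 * pi)) =
    of_real (exp (log_moment r 0 s)) * (LINT \<theta>:{-pi..pi}|lborel. exp (char_exponent r s \<theta>) * cis (real N * \<theta>))"
proof -
  define c where "c m = fps_nth (H_gf r 1) m * exp (- (real m * s))" for m
  define f where "f m \<theta> = indicator {-pi..pi} \<theta> *\<^sub>R (of_real (c m) * cis (of_int (int N - int m) * \<theta>))" for m \<theta>
  have [measurable]: "cis \<in> borel_measurable borel"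
    by (intro borel_measurable_continuous_onI continuous_intros)
  have sm: "summable (\<lambda>m. \<bar>c m\<bar>)" using gf_on_circle_sums(2)[OF s, of r] by (simp add: c_def abs_mult)
  have norm_f: "norm (f m \<theta>) = indicator {-pi..pi} \<theta> * \<bar>c m\<bar>" for m \<theta> by (simp add: f_def norm_mult)
  have int_f: "integral\<^sup>L lborel (f m) = of_real (c m) * (if m = N then of_real (2 * pi) else 0)" for m
    using integral_cis_period[of "int N - int m"]
    unfolding f_def set_lebesgue_integral_def by (simp flip: mult_scaleR_right split: if_splits)
  have "(\<lambda>m. integral\<^sup>L lborel (f m)) sums (\<integral>\<theta>. (\<Sum>m. f m \<theta>) \<partial>lborel)"
  proof (rule sums_integral)
    show "integrable lborel (f m)" for m
    proof (rule Bochner_Integration.integrable_bound)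
      show "integrable lborel (\<lambda>\<theta>. indicator {-pi..pi} \<theta> * \<bar>c m\<bar>)" by simp
      show "f m \<in> borel_measurable lborel" unfolding f_def by measurable
    qed (simp add: norm_f)
    show "AE \<theta> in lborel. summable (\<lambda>m. norm (f m \<theta>))"
      unfolding norm_f using sm by (intro AE_I2 summable_mult)
    show "summable (\<lambda>m. \<integral>\<theta>. norm (f m \<theta>) \<partial>lborel)"
      unfolding norm_f using sm by (simp add: summable_mult)
  qed
  moreover have "(\<lambda>m. integral\<^sup>L lborel (f m)) sums (of_real (c N) * of_real (2 * pi))"
    unfolding int_f using sums_If_finite_set[of "{N}"] sums_single[of N "\<lambda>m. of_real (c m) * complex_of_real (2 * pi)"]
    by (simp add: if_distrib cong: if_cong)
  ultimately have "of_real (c N * (2 * pi)) = (\<integral>\<theta>. (\<Sum>m. f m \<theta>) \<partial>lborel)"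
    using sums_unique2 by fastforce
  also have "\<dots> = (\<integral>\<theta>. of_real (exp (log_moment r 0 s)) * (indicator {-pi..pi} \<theta> *\<^sub>R (exp (char_exponent r s \<theta>) * cis (real N * \<theta>))) \<partial>lborel)"
  proof (rule Bochner_Integration.integral_cong[OF refl])
    fix \<theta> :: real
    have "(\<lambda>m. indicator {-pi..pi} \<theta> *\<^sub>R (of_real (c m) * cis (- (real m * \<theta>)) * cis (real N * \<theta>))) sums
        (indicator {-pi..pi} \<theta> *\<^sub>R (of_real (exp (log_moment r 0 s)) * exp (char_exponent r s \<theta>) * cis (real N * \<theta>)))"
      unfolding c_def by (intro sums_scaleR_right sums_mult2 gf_on_circle_sums s)
    moreover have "cis (- (real m * \<theta>)) * cis (real N * \<theta>) = cis (of_int (int N - int m) * \<theta>)" for m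
      by (simp add: cis_mult algebra_simps)
    ultimately have "(\<lambda>m. f m \<theta>) sums
        (indicator {-pi..pi} \<theta> *\<^sub>R (of_real (exp (log_moment r 0 s)) * exp (char_exponent r s \<theta>) * cis (real N * \<theta>)))"
      by (simp add: f_def mult.assoc)
    thus "(\<Sum>m. f m \<theta>) = of_real (exp (log_moment r 0 s)) * (indicator {-pi..pi} \<theta> *\<^sub>R (exp (char_exponent r s \<theta>) * cis (real N * \<theta>)))"
      by (simp add: sums_iff mult.assoc)
  qed
  also have "\<dots> = of_real (exp (log_moment r 0 s)) * (LINT \<theta>:{-pi..pi}|lborel. exp (char_exponent r s \<theta>) * cis (real N * \<theta>))"
    unfolding set_lebesgue_integral_def by (rule integral_mult_right_zero)
  finally show ?thesis by (simp add: c_def)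
qed

section \<open>Gaussian limit at the saddle point\<close>

lemma log_moment_2_pos:
  assumes "r > 0" "s > 0" shows "log_moment r 2 s > 0"
proof -
  have "0 < log_coeff r 1 * real 1 ^ 2 * exp (- (real 1 * s))"
    using log_coeff_ge_1[of r 1] assms by simp
  also have "\<dots> = (\<Sum>m\<in>{1}. log_coeff r m * real m ^ 2 * exp (- (real m * s)))" by simp
  also have "\<dots> \<le> log_moment r 2 s"
    unfolding log_moment_def
    by (intro sum_le_suminf summable_log_coeff) (use assms in \<open>auto intro!: mult_nonneg_nonneg log_coeff_nonneg\<close>)
  finally show ?thesis .
qed

lemma tendsto_0_squeeze:
  fixes f g :: "nat \<Rightarrow> real"
  assumes "eventually (\<lambda>n. f n \<le> g n) sequentially" "g \<longlonglongrightarrow> 0" "\<And>n. 0 \<le> f n"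
  shows "f \<longlonglongrightarrow> 0"
  by (rule tendsto_sandwich[OF always_eventually assms(1) tendsto_const assms(2)]) (use assms(3) in blast)

text \<open>
  The value at \<open>n = 0\<close> is only required to be positive, because the first moment never vanishes.
\<close>

locale saddle_points =
  fixes r :: nat and s :: "nat \<Rightarrow> real"
  assumes r_pos: "r > 0" and s_pos: "s n > 0"
    and saddle: "n > 0 \<Longrightarrow> log_moment r 1 (s n) = real n"
begin

definition \<sigma> :: "nat \<Rightarrow> real" where "\<sigma> n = sqrt (log_moment r 2 (s n))"

lemma \<sigma>_pos: "\<sigma> n > 0"
  using log_moment_2_pos[OF r_pos s_pos[of n]] by (simp add: \<sigma>_def)

lemma \<sigma>_squared: "\<sigma> n ^ 2 = log_moment r 2 (s n)"
  using log_moment_2_pos[OF r_pos s_pos[of n]] by (simp add: \<sigma>_def)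

lemma s_tendsto_0: "s \<longlonglongrightarrow> 0"
proof -
  obtain K where K: "K > 0" "\<And>s. s > 0 \<Longrightarrow> log_moment r 1 s \<le> K / s ^ 2"
    using log_moment_le[of r 1] by (auto simp: power2_eq_square)
  have "s n ^ 2 \<le> K / real n" if "n > 0" for n
    using K(2)[OF s_pos[of n]] saddle[OF that] s_pos[of n] that by (simp add: field_simps)
  hence "s n \<le> sqrt (K / real n)" if "n > 0" for n using that by (intro real_le_rsqrt) auto
  hence "eventually (\<lambda>n. s n \<le> sqrt (K / real n)) sequentially"
    by (intro eventually_mono[OF eventually_gt_at_top[of 0]])
  moreover have "(\<lambda>n. sqrt (K / real n)) \<longlonglongrightarrow> 0"
    using tendsto_real_sqrt[OF lim_const_over_n[of K]] by simp
  ultimately show ?thesis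
    by (rule tendsto_0_squeeze) (rule less_imp_le[OF s_pos])
qed

lemma s_le_1: "eventually (\<lambda>n. s n \<le> 1) sequentially"
  using order_tendstoD(2)[OF s_tendsto_0, of 1] by (auto elim: eventually_mono)

lemma inverse_\<sigma>_tendsto_0: "(\<lambda>n. 1 / \<sigma> n) \<longlonglongrightarrow> 0"
proof -
  have "eventually (\<lambda>n. 1 / \<sigma> n \<le> sqrt (exp 4 * s n ^ 3)) sequentially"
    using s_le_1
  proof eventually_elim
    case (elim n)
    have "exp (- 4) / s n ^ 3 \<le> \<sigma> n ^ 2"
      unfolding \<sigma>_squared using elim by (intro log_moment_2_ge r_pos s_pos)
    hence "(1 / \<sigma> n) ^ 2 \<le> exp 4 * s n ^ 3"
      using s_pos[of n] \<sigma>_pos[of n] by (simp add: exp_minus field_simps)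
    thus ?case by (rule real_le_rsqrt)
  qed
  moreover have "(\<lambda>n. sqrt (exp 4 * s n ^ 3)) \<longlonglongrightarrow> 0"
    using tendsto_real_sqrt[OF tendsto_mult[OF tendsto_const[of "exp 4"] tendsto_power[OF s_tendsto_0, of 3]]] by simp
  ultimately show ?thesis
    by (rule tendsto_0_squeeze) (simp add: less_imp_le[OF \<sigma>_pos])
qed

text \<open>
  The third moment is \<open>O(s\<^sup>-\<^sup>4)\<close> and \<open>\<sigma>\<^sup>2\<close> is at least a multiple of \<open>s\<^sup>-\<^sup>3\<close>, so the ratio is of
  order \<open>sqrt s\<close>. The estimate is made for squares.
\<close>

lemma third_moment_ratio: "(\<lambda>n. log_moment r 3 (s n) / \<sigma> n ^ 3) \<longlonglongrightarrow> 0"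
proof -
  obtain K where K: "K > 0" "\<And>s. s > 0 \<Longrightarrow> log_moment r 3 s \<le> K / s ^ 4"
    using log_moment_le[of r 3] by auto
  have nn: "log_moment r 3 (s n) \<ge> 0" for n
    unfolding log_moment_def using s_pos[of n]
    by (intro suminf_nonneg summable_log_coeff) (auto intro!: mult_nonneg_nonneg log_coeff_nonneg)
  have "eventually (\<lambda>n. log_moment r 3 (s n) / \<sigma> n ^ 3 \<le> sqrt (K ^ 2 * exp 12 * s n)) sequentially"
    using s_le_1
  proof eventually_elim
    case (elim n)
    have "exp (- 4) / s n ^ 3 \<le> \<sigma> n ^ 2"
      unfolding \<sigma>_squared using elim by (intro log_moment_2_ge r_pos s_pos)
    hence "(exp (- 4) / s n ^ 3) ^ 3 \<le> (\<sigma> n ^ 2) ^ 3"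
      using s_pos[of n] by (intro power_mono) auto
    moreover have "(log_moment r 3 (s n)) ^ 2 \<le> (K / s n ^ 4) ^ 2"
      using K(2)[OF s_pos[of n]] nn[of n] by (intro power_mono)
    ultimately have "(log_moment r 3 (s n)) ^ 2 / (\<sigma> n ^ 2) ^ 3 \<le> (K / s n ^ 4) ^ 2 / (exp (- 4) / s n ^ 3) ^ 3"
      using s_pos[of n] by (intro frac_le) auto
    also have "\<dots> = K ^ 2 * exp 12 * s n"
    proof -
      have "exp (- 4 :: real) ^ 3 = 1 / exp 12"
      proof -
        have "exp (- 4 :: real) ^ 3 = exp (- 12)" by (simp flip: exp_of_nat_mult)
        thus ?thesis by (simp add: exp_minus inverse_eq_divide)
      qed
      thus ?thesis using s_pos[of n] by (simp add: power_divide field_simps flip: power_mult power_add) (simp add: eval_nat_numeral)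
    qed
    finally have "(log_moment r 3 (s n) / \<sigma> n ^ 3) ^ 2 \<le> K ^ 2 * exp 12 * s n"
      by (simp add: power_divide mult.commute flip: power_mult)
    thus ?case by (rule real_le_rsqrt)
  qed
  moreover have "(\<lambda>n. sqrt (K ^ 2 * exp 12 * s n)) \<longlonglongrightarrow> 0"
    using tendsto_real_sqrt[OF tendsto_mult[OF tendsto_const[of "K ^ 2 * exp 12"] s_tendsto_0]] by simp
  ultimately show ?thesis
    by (rule tendsto_0_squeeze) (simp add: nn less_imp_le[OF \<sigma>_pos])
qed

text \<open>
  The integrand of Cauchy's formula for \<open>C(n)\<close>, divided by its value at the saddle point and in
  the variable in which it has a Gaussian limit.
\<close>

definition wave :: "nat \<Rightarrow> real \<Rightarrow> complex" where
  "wave n u = exp (char_exponent r (s n) (u / \<sigma> n)) * cis (real n * (u / \<sigma> n))"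

text \<open>
  Expand each \<open>cis (- m \<theta>)\<close> to second order. The linear terms add up to \<open>- i n \<theta>\<close> by the choice of
  the saddle point and cancel against the factor \<open>cis (n \<theta>)\<close>, the quadratic terms add up to
  \<open>- u\<^sup>2 / 2\<close> by the choice of \<open>\<sigma>\<close>, and the remainders are at most a multiple of \<open>|u|\<^sup>3\<close>
  times the ratio of the previous lemma because all coefficients are nonnegative.
\<close>

lemma wave_tendsto: "(\<lambda>n. wave n u) \<longlonglongrightarrow> of_real (exp (- (u ^ 2 / 2)))"
proof -
  define e where "e n = char_exponent r (s n) (u / \<sigma> n) + \<i> * of_real (real n * (u / \<sigma> n))" for n
  have "eventually (\<lambda>n. norm (e n - of_real (- (u ^ 2 / 2))) \<le> \<bar>u\<bar> ^ 3 / 6 * (log_moment r 3 (s n) / \<sigma> n ^ 3)) sequentially"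
    using eventually_gt_at_top[of 0]
  proof eventually_elim
    case (elim n)
    define \<theta> where "\<theta> = u / \<sigma> n"
    define b where "b m = log_coeff r m * exp (- (real m * s n))" for m
    note sm = summable_log_coeff[OF s_pos[of n], of r]
    have b_nonneg: "b m \<ge> 0" for m by (simp add: b_def log_coeff_nonneg)
    have s0: "(\<lambda>m. of_real (b m) * (cis (- (real m * \<theta>)) - 1)) sums char_exponent r (s n) \<theta>"
      unfolding char_exponent_def b_def
      by (intro summable_sums summable_bounded_log_coeff[OF s_pos norm_cis_minus_1_le])
    have "(\<lambda>m. b m * real m) sums real n"
      using summable_sums[OF sm[of 1]] saddle[OF elim] by (simp add: log_moment_def b_def mult_ac)
    hence s1: "(\<lambda>m. of_real (b m * real m) * (\<i> * of_real \<theta>)) sums (of_real (real n) * (\<i> * of_real \<theta>))"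
      by (intro sums_mult2 sums_of_real)
    have "(\<lambda>m. b m * real m ^ 2) sums (\<sigma> n ^ 2)"
      using summable_sums[OF sm[of 2]] by (simp add: log_moment_def b_def mult_ac \<sigma>_squared)
    hence s2: "(\<lambda>m. of_real (b m * real m ^ 2) * of_real (\<theta> ^ 2 / 2)) sums (of_real (\<sigma> n ^ 2) * complex_of_real (\<theta> ^ 2 / 2))"
      by (intro sums_mult2 sums_of_real)
    have "(\<lambda>m. b m * real m ^ 3) sums log_moment r 3 (s n)"
      using summable_sums[OF sm[of 3]] by (simp add: log_moment_def b_def mult_ac)
    hence s3: "(\<lambda>m. b m * real m ^ 3 * (\<bar>\<theta>\<bar> ^ 3 / 6)) sums (log_moment r 3 (s n) * (\<bar>\<theta>\<bar> ^ 3 / 6))"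
      by (rule sums_mult2)
    have eq: "e n - of_real (- (u ^ 2 / 2)) =
        char_exponent r (s n) \<theta> + of_real (real n) * (\<i> * of_real \<theta>) + of_real (\<sigma> n ^ 2) * complex_of_real (\<theta> ^ 2 / 2)"
      using \<sigma>_pos[of n] by (simp add: e_def \<theta>_def power_divide mult_ac)
    have terms: "norm (of_real (b m) * (cis (- (real m * \<theta>)) - 1) + of_real (b m * real m) * (\<i> * of_real \<theta>)
          + of_real (b m * real m ^ 2) * of_real (\<theta> ^ 2 / 2)) \<le> b m * real m ^ 3 * (\<bar>\<theta>\<bar> ^ 3 / 6)" for m
    proof -
      define x where "x = - (real m * \<theta>)"
      have "norm (cis x - (1 + \<i> * of_real x - of_real (x ^ 2 / 2))) \<le> \<bar>x\<bar> ^ 3 / 6"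
        using iexp_approx1[of x 2] by (simp add: cis_conv_exp eval_nat_numeral algebra_simps)
      hence "b m * norm (cis x - (1 + \<i> * of_real x - of_real (x ^ 2 / 2))) \<le> b m * (\<bar>x\<bar> ^ 3 / 6)"
        by (intro mult_left_mono b_nonneg)
      moreover have "of_real (b m) * (cis (- (real m * \<theta>)) - 1) + of_real (b m * real m) * (\<i> * of_real \<theta>)
          + of_real (b m * real m ^ 2) * of_real (\<theta> ^ 2 / 2) = of_real (b m) * (cis x - (1 + \<i> * of_real x - of_real (x ^ 2 / 2)))"
        by (simp add: x_def algebra_simps power_mult_distrib)
      ultimately show ?thesis
        using b_nonneg[of m] by (simp add: norm_mult x_def abs_mult power_mult_distrib mult_ac)
    qed
    have "norm (e n - of_real (- (u ^ 2 / 2))) \<le> log_moment r 3 (s n) * (\<bar>\<theta>\<bar> ^ 3 / 6)"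
      unfolding eq sums_unique[OF sums_add[OF sums_add[OF s0 s1] s2]] sums_unique[OF s3]
      by (rule norm_suminf_le[OF terms sums_summable[OF s3]])
    also have "\<dots> = \<bar>u\<bar> ^ 3 / 6 * (log_moment r 3 (s n) / \<sigma> n ^ 3)"
      using \<sigma>_pos[of n] by (simp add: \<theta>_def abs_divide power_divide field_simps)
    finally show ?case .
  qed
  moreover have "(\<lambda>n. \<bar>u\<bar> ^ 3 / 6 * (log_moment r 3 (s n) / \<sigma> n ^ 3)) \<longlonglongrightarrow> 0"
    by (rule tendsto_mult_right_zero[OF third_moment_ratio])
  ultimately have "(\<lambda>n. e n - of_real (- (u ^ 2 / 2))) \<longlonglongrightarrow> 0"
    by (rule Lim_null_comparison)
  hence "e \<longlonglongrightarrow> of_real (- (u ^ 2 / 2))" by (rule LIM_zero_cancel)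
  hence "(\<lambda>n. exp (e n)) \<longlonglongrightarrow> exp (of_real (- (u ^ 2 / 2)))" by (rule tendsto_exp)
  thus ?thesis by (simp add: e_def wave_def exp_add cis_conv_exp exp_of_real del: of_real_minus)
qed
end

section \<open>Hermite polynomials\<close>

fun hermite_poly :: "nat \<Rightarrow> real poly" where
  "hermite_poly 0 = 1"
| "hermite_poly (Suc d) = [:0, 1:] * hermite_poly d - Polynomial.smult 2 (pderiv (hermite_poly d))"

lemma pderiv_hermite_poly: "pderiv (hermite_poly (Suc d)) = Polynomial.smult (of_nat (Suc d)) (hermite_poly d)"
proof (induction d)
  case 0
  show ?case by (simp add: pderiv_pCons)
next
  case (Suc d)
  have "pderiv (hermite_poly (Suc (Suc d))) =
      hermite_poly (Suc d) + [:0, 1:] * pderiv (hermite_poly (Suc d))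
        - Polynomial.smult 2 (pderiv (pderiv (hermite_poly (Suc d))))"
    by (subst hermite_poly.simps(2)) (simp add: pderiv_diff pderiv_mult pderiv_smult pderiv_pCons)
  also have "\<dots> = hermite_poly (Suc d) + Polynomial.smult (of_nat (Suc d)) (hermite_poly (Suc d))"
    unfolding Suc.IH pderiv_smult by (simp only: hermite_poly.simps(2)) (simp add: smult_diff_right mult.commute)
  also have "\<dots> = Polynomial.smult (of_nat (Suc (Suc d))) (hermite_poly (Suc d))"
    by (simp only: of_nat_Suc[of "Suc d"] smult_add_left smult_1_left)
  finally show ?case .
qed

lemma hermite_poly_rec:
  "hermite_poly (Suc (Suc d)) =
     [:0, 1:] * hermite_poly (Suc d) - Polynomial.smult (2 * of_nat (Suc d)) (hermite_poly d)"
  by (subst hermite_poly.simps(2)) (simp only: pderiv_hermite_poly smult_smult)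

text \<open>
  Used to identify the various descriptions of the Hermite polynomials with each other.
\<close>

lemma three_term_unique:
  fixes g h :: "nat \<Rightarrow> real"
  assumes "g 0 = h 0" "g 1 = x * g 0" "h 1 = x * h 0"
    and "\<And>d. g (d + 2) = x * g (d + 1) - 2 * (real d + 1) * g d"
    and "\<And>d. h (d + 2) = x * h (d + 1) - 2 * (real d + 1) * h d"
  shows "g d = h d"
proof (induction d rule: less_induct)
  case (less d)
  consider "d = 0" | "d = 1" | k where "d = k + 2"
    by (metis One_nat_def add_2_eq_Suc' not0_implies_Suc)
  thus ?case
    by cases (use assms less.IH in auto)
qed

text \<open>
  The differential equation of \<open>exp (x t - t\<^sup>2)\<close>, read off coefficientwise.
\<close>

lemma fps_exp_ode_three_term:
  fixes W :: "real fps" and x :: real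
  assumes "fps_deriv W = (fps_const x - 2 * fps_X) * W"
  defines "g \<equiv> \<lambda>d. fact d * fps_nth W d"
  shows "g 1 = x * g 0" "g (d + 2) = x * g (d + 1) - 2 * (real d + 1) * g d"
proof -
  have eq: "real (Suc d) * fps_nth W (Suc d) =
      x * fps_nth W d - 2 * (if d = 0 then 0 else fps_nth W (d - 1))" for d
  proof -
    have "fps_nth (fps_deriv W) d = fps_nth (fps_const x * W - fps_const 2 * (fps_X * W)) d"
      by (subst assms) (simp add: algebra_simps numeral_fps_const)
    thus ?thesis by (simp del: mult_minus_left add: fps_mult_left_const_nth split: if_splits)
  qed
  show "g 1 = x * g 0" using eq[of 0] by (simp add: g_def)
  show "g (d + 2) = x * g (d + 1) - 2 * (real d + 1) * g d"
  proof -
    have "g (d + 2) = fact (d + 1) * (real (Suc (d + 1)) * fps_nth W (Suc (d + 1)))"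
      by (simp add: g_def algebra_simps)
    also have "\<dots> = fact (d + 1) * (x * fps_nth W (d + 1) - 2 * fps_nth W d)"
      by (subst eq) simp
    also have "\<dots> = x * g (d + 1) - 2 * (real d + 1) * g d"
      by (simp add: g_def algebra_simps)
    finally show ?thesis .
  qed
qed

lemma hermite_three_term:
  "hermite 0 x = 1" "hermite 1 x = x" "hermite (d + 2) x = x * hermite (d + 1) x - 2 * (real d + 1) * hermite d x"
proof -
  define W :: "real fps" where "W = fps_compose (fps_exp 1) (- (fps_X ^ 2) + fps_const x * fps_X)"
  have "fps_deriv W = (fps_const x - 2 * fps_X) * W"
    unfolding W_def by (subst fps_compose_deriv) (simp_all add: fps_deriv_power algebra_simps numeral_fps_const)
  note * = fps_exp_ode_three_term[OF this, folded W_def]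
  have h: "hermite d x = fact d * fps_nth W d" for d by (simp add: hermite_def W_def)
  show 0: "hermite 0 x = 1" by (simp add: hermite_def)
  show "hermite 1 x = x" using *(1) 0 by (simp add: h)
  show "hermite (d + 2) x = x * hermite (d + 1) x - 2 * (real d + 1) * hermite d x"
    using *(2)[of d] by (simp only: h)
qed

lemma hermite_eq_poly: "hermite d x = poly (hermite_poly d) x"
proof (rule three_term_unique[of "\<lambda>d. hermite d x" "\<lambda>d. poly (hermite_poly d) x" x])
  show "poly (hermite_poly (d + 2)) x = x * poly (hermite_poly (d + 1)) x - 2 * (real d + 1) * poly (hermite_poly d) x" for d
    using arg_cong[OF hermite_poly_rec[of d], of "\<lambda>p. poly p x"]
    by (simp del: hermite_poly.simps add: algebra_simps)
qed (use hermite_three_term[where x = x] in auto)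

text \<open>
  The numbers \<open>m i\<close> are the coefficients of \<open>exp (- t\<^sup>2)\<close> times \<open>i!\<close>, so the sum is \<open>d!\<close> times a coefficient of
  \<open>exp (x t) exp (- t\<^sup>2)\<close>. In this form the Hermite polynomials appear below as Gaussian means.
\<close>

lemma hermite_binomial_sum:
  fixes m :: "nat \<Rightarrow> real"
  assumes even: "\<And>k. m (2 * k) = (-1) ^ k * fact (2 * k) / fact k"
    and odd: "\<And>k. m (2 * k + 1) = 0"
  shows "(\<Sum>j\<le>d. of_nat (d choose j) * x ^ j * m (d - j)) = hermite d x"
proof -
  define M where "M = Abs_fps (\<lambda>i. m i / fact i)"
  have "fps_deriv M = - 2 * fps_X * M"
  proof (rule fps_ext)
    fix i
    have "m (Suc i) / fact i = - 2 * (if i = 0 then 0 else m (i - 1) / fact (i - 1))"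
    proof (cases "even i")
      case True
      then obtain k where i: "i = 2 * k" by (auto elim: evenE)
      have "m (i - 1) = 0" if "i \<noteq> 0" using odd[of "k - 1"] that i by (cases k) auto
      thus ?thesis using odd[of k] i by auto
    next
      case False
      then obtain k where "i = 2 * k + 1" by (auto elim: oddE)
      moreover have "m (2 * k + 2) = - 2 * (2 * real k + 1) * m (2 * k)"
      proof -
        have "m (2 * k + 2) = (-1) ^ (k + 1) * fact (2 * k + 2) / fact (k + 1)"
          using even[of "k + 1"] by simp
        also have "fact (2 * k + 2) = (2 * (real k + 1)) * (2 * real k + 1) * fact (2 * k)"
          by (simp add: algebra_simps)
        also have "(-1) ^ (k + 1) * \<dots> / fact (k + 1) =
            - 2 * (2 * real k + 1) * ((-1) ^ k * fact (2 * k) / fact k) * ((real k + 1) / (real k + 1))"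
          by (simp only: fact_Suc Suc_eq_plus1[symmetric]) (simp add: divide_simps, simp add: algebra_simps)
        finally show ?thesis by (simp add: even add_nonneg_eq_0_iff)
      qed
      moreover have "fact i = (2 * real k + 1) * fact (2 * k)"
        using \<open>i = 2 * k + 1\<close> by simp
      moreover have "2 * real k + 1 \<noteq> 0" by linarith
      ultimately show ?thesis
        by (simp add: \<open>i = 2 * k + 1\<close> divide_simps del: fact_Suc) (simp add: algebra_simps)
    qed
    moreover have "fps_nth (fps_deriv M) i = m (Suc i) / fact i"
      by (simp add: M_def del: of_nat_Suc)
    moreover have "- 2 * fps_X * M = fps_const (- 2) * (fps_X * M)"
      by (simp add: numeral_fps_const mult.assoc flip: fps_const_neg)
    ultimately show "fps_nth (fps_deriv M) i = fps_nth (- 2 * fps_X * M) i"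
      by (simp add: M_def)
  qed
  define W where "W = fps_exp x * M"
  have "fps_deriv W = (fps_const x - 2 * fps_X) * W"
    unfolding W_def using \<open>fps_deriv M = _\<close> by (simp add: algebra_simps)
  note * = fps_exp_ode_three_term[OF this]
  have "(\<Sum>j\<le>d. of_nat (d choose j) * x ^ j * m (d - j)) = fact d * fps_nth W d" for d
    unfolding W_def fps_mult_nth M_def sum_distrib_left atMost_atLeast0
    by (intro sum.cong refl) (simp add: binomial_fact field_simps)
  moreover have "fact d * fps_nth W d = hermite d x"
  proof (rule three_term_unique[of "\<lambda>d. fact d * fps_nth W d" "\<lambda>d. hermite d x" x])
    show "fact 0 * fps_nth W 0 = hermite 0 x"
      using even[of 0] by (simp add: hermite_three_term(1) W_def M_def)
    show "hermite 1 x = x * hermite 0 x" by (simp only: hermite_three_term(1,2) mult_1_right)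
  qed (fact * hermite_three_term(3))+
  ultimately show ?thesis by simp
qed

section \<open>Alternating signs and the zeros of Hermite polynomials\<close>

lemma alternating_imp_zeros:
  fixes f :: "real \<Rightarrow> real"
  assumes cont: "continuous_on UNIV f"
    and z: "\<And>k. k < d \<Longrightarrow> z k < z (Suc k)"
    and sgn: "\<And>k. k \<le> d \<Longrightarrow> 0 < (-1) ^ (d - k) * f (z k)"
  shows "\<exists>x. \<forall>i<d. f (x i) = 0 \<and> z i < x i \<and> x i < z (Suc i)"
proof -
  have "\<exists>y. f y = 0 \<and> z i < y \<and> y < z (Suc i)" if "i < d" for i
  proof -
    have d: "d - i = Suc (d - Suc i)" using that by simp
    have s1: "0 < (-1) ^ (d - Suc i) * f (z (Suc i))" and s2: "0 > (-1) ^ (d - Suc i) * f (z i)"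
      using sgn[of i] sgn[of "Suc i"] that unfolding d by auto
    have "\<exists>y\<ge>z i. y \<le> z (Suc i) \<and> (-1) ^ (d - Suc i) * f y = 0"
      by (rule IVT') (use s1 s2 z[OF that] cont in \<open>auto intro!: continuous_intros elim: continuous_on_subset\<close>)
    then obtain y where y: "z i \<le> y" "y \<le> z (Suc i)" "f y = 0" by auto
    with s1 s2 have "y \<noteq> z i" "y \<noteq> z (Suc i)" by auto
    with y show ?thesis by (intro exI[of _ y]) auto
  qed
  thus ?thesis by (metis (no_types))
qed

lemma strictly_increasing_upto:
  fixes x :: "nat \<Rightarrow> real"
  assumes "\<And>k. Suc k < d \<Longrightarrow> x k < x (Suc k)"
  shows "i < j \<Longrightarrow> j < d \<Longrightarrow> x i < x j"
proof (induction j)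
  case (Suc j)
  thus ?case using assms[of j] by (cases "i = j") auto
qed auto

lemma hermite_poly_monic: "degree (hermite_poly d) = d \<and> lead_coeff (hermite_poly d) = 1"
proof (induction d)
  case (Suc d)
  have "degree (Polynomial.smult 2 (pderiv (hermite_poly d))) \<le> degree (hermite_poly d)"
    by (simp add: degree_pderiv)
  also have "\<dots> < degree ([:0, 1:] * hermite_poly d)"
    using Suc by auto
  finally have less: "degree (- Polynomial.smult 2 (pderiv (hermite_poly d))) < degree ([:0, 1:] * hermite_poly d)"
    by simp
  have "degree ([:0, 1:] * hermite_poly d) = Suc d" "lead_coeff ([:0, 1:] * hermite_poly d) = 1"
    using Suc by auto
  thus ?case using degree_add_eq_left[OF less] lead_coeff_add_le[OF less] by simp
qed simp


lemma hermite_minus: "hermite d (- x) = (-1) ^ d * hermite d x"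
proof -
  have "(-1) ^ d * hermite d (- x) = hermite d x"
  proof (rule three_term_unique[of "\<lambda>d. (-1) ^ d * hermite d (- x)" "\<lambda>d. hermite d x" x])
    show "(-1) ^ (d + 2) * hermite (d + 2) (- x) =
        x * ((-1) ^ (d + 1) * hermite (d + 1) (- x)) - 2 * (real d + 1) * ((-1) ^ d * hermite d (- x))" for d
      by (subst hermite_three_term(3)) (simp add: algebra_simps)
  qed (use hermite_three_term[where x = x] hermite_three_term[where x = "- x"] in auto)
  hence "(-1) ^ d * ((-1) ^ d * hermite d (- x)) = (-1) ^ d * hermite d x" by simp
  thus ?thesis by (simp flip: mult.assoc power_add)
qed

lemma monic_poly_eq_prod_roots:
  fixes p :: "real poly" and x :: "nat \<Rightarrow> real"
  assumes "degree p = d" "lead_coeff p = 1" "inj_on x {..<d}" "\<And>i. i < d \<Longrightarrow> poly p (x i) = 0"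
  shows "p = (\<Prod>i<d. [:- x i, 1:])"
proof (rule poly_eqI_degree_lead_coeff[where A = "x ` {..<d}"])
  have deg: "degree (\<Prod>i<d. [:- x i, 1:]) = d" by (subst degree_prod_eq_sum_degree) auto
  have "lead_coeff (\<Prod>i<d. [:- x i, 1:]) = 1" by (simp add: lead_coeff_prod)
  thus "coeff p d = coeff (\<Prod>i<d. [:- x i, 1:]) d" using assms(1,2) deg by simp
  show "degree p \<le> d" "degree (\<Prod>i<d. [:- x i, 1:]) \<le> d" using assms deg by auto
  show "d \<le> card (x ` {..<d})" using assms(3) by (simp add: card_image)
qed (use assms in \<open>auto simp: poly_prod\<close>)

lemma pderiv_sign_at_simple_root:
  fixes x :: "nat \<Rightarrow> real"
  assumes x: "\<And>i j. i < j \<Longrightarrow> j < d \<Longrightarrow> x i < x j" and i: "i < d"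
  shows "0 < (-1) ^ (d - Suc i) * poly (pderiv (\<Prod>j<d. [:- x j, 1:])) (x i)"
proof -
  define Q where "Q = (\<Prod>j\<in>{..<d} - {i}. [:- x j, 1:])"
  have "(\<Prod>j<d. [:- x j, 1:]) = [:- x i, 1:] * Q"
    unfolding Q_def by (rule prod.remove) (use i in auto)
  hence "poly (pderiv (\<Prod>j<d. [:- x j, 1:])) (x i) = poly Q (x i)"
    by (simp add: pderiv_mult pderiv_pCons del: mult_pCons_left)
  also have "\<dots> = (\<Prod>j\<in>{..<i} \<union> {i<..<d}. x i - x j)"
    unfolding Q_def poly_prod by (rule prod.cong) (use i in auto)
  also have "\<dots> = (\<Prod>j<i. x i - x j) * (\<Prod>j\<in>{i<..<d}. - (x j - x i))"
    by (subst prod.union_disjoint) auto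
  also have "\<dots> = (-1) ^ (d - Suc i) * ((\<Prod>j<i. x i - x j) * (\<Prod>j\<in>{i<..<d}. x j - x i))"
    by (subst prod_uminus) simp
  finally have "(-1) ^ (d - Suc i) * poly (pderiv (\<Prod>j<d. [:- x j, 1:])) (x i) =
      (\<Prod>j<i. x i - x j) * (\<Prod>j\<in>{i<..<d}. x j - x i)"
    by (simp flip: mult.assoc power_add)
  also have "\<dots> > 0"
    by (intro mult_pos_pos prod_pos) (use x i in auto)
  finally show ?thesis .
qed

text \<open>
  Induction on \<open>d\<close>. The alternation gives \<open>d\<close> zeros of the polynomial \<open>H\<close> of degree \<open>d\<close>,
  hence its factorisation. At these zeros the next polynomial, which is \<open>x H(x) - 2 H'(x)\<close>, equals
  \<open>- 2 H'(x)\<close>, and the sign of the derivative alternates because the zeros are simple. The behaviour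
  at infinity supplies two more points, one on each side.
\<close>

lemma hermite_alternates:
  "\<exists>z. (\<forall>k<d. z k < z (Suc k)) \<and> (\<forall>k\<le>d. 0 < (-1) ^ (d - k) * hermite d (z k))"
proof (induction d)
  case 0
  show ?case by (simp add: hermite_three_term)
next
  case (Suc d)
  then obtain z where z: "\<And>k. k < d \<Longrightarrow> z k < z (Suc k)"
    "\<And>k. k \<le> d \<Longrightarrow> 0 < (-1) ^ (d - k) * hermite d (z k)" by blast
  have "continuous_on UNIV (hermite d)"
    unfolding hermite_eq_poly[abs_def] by (intro continuous_intros)
  from alternating_imp_zeros[OF this z] obtain x
    where x: "\<And>i. i < d \<Longrightarrow> hermite d (x i) = 0" "\<And>i. i < d \<Longrightarrow> z i < x i" "\<And>i. i < d \<Longrightarrow> x i < z (Suc i)"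
    by metis
  have "x k < x (Suc k)" if "Suc k < d" for k
    using x(3)[of k] x(2)[of "Suc k"] that by simp
  hence mono: "x i < x j" if "i < j" "j < d" for i j
    using strictly_increasing_upto[of d x i j] that by blast
  have "inj_on x {..<d}"
    by (rule inj_onI) (metis lessThan_iff less_irrefl linorder_neqE_nat mono)
  hence "hermite_poly d = (\<Prod>i<d. [:- x i, 1:])"
    using hermite_poly_monic[of d] x(1) by (intro monic_poly_eq_prod_roots) (auto simp: hermite_eq_poly)
  hence sgn: "0 < (-1) ^ (d - i) * hermite (Suc d) (x i)" if "i < d" for i
    using pderiv_sign_at_simple_root[of d x i, OF mono that] x(1)[OF that] that
    by (simp add: hermite_eq_poly Suc_diff_Suc[symmetric] zero_less_mult_iff mult_less_0_iff)
  obtain N where N: "\<And>y. y \<ge> N \<Longrightarrow> hermite (Suc d) y > 0"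
    using poly_pinfty_gt_lc[of "hermite_poly (Suc d)"] hermite_poly_monic[of "Suc d"]
    unfolding hermite_eq_poly by (fastforce intro: less_le_trans[OF zero_less_one] simp del: hermite_poly.simps)
  \<comment> \<open>Large enough for the leading term to determine the sign, and beyond all zeros on both sides.\<close>
  define B where "B = max N 1 + (\<Sum>i<d. \<bar>x i\<bar>)"
  have B: "\<bar>x i\<bar> < B" if "i < d" for i
    using member_le_sum[of i "{..<d}" "\<lambda>i. \<bar>x i\<bar>"] that by (simp add: B_def)
  have "B \<ge> N" "B > 0" 
  proof -
    have "0 \<le> (\<Sum>i<d. \<bar>x i\<bar>)" by (rule sum_nonneg) simp
    thus "B \<ge> N" "B > 0" unfolding B_def by linarith+
  qed
  define w where "w k = (if k = 0 then - B else if k \<le> d then x (k - 1) else B)" for k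
  have "w k < w (Suc k)" if "k < Suc d" for k
    using that B[of "k - 1"] B[of k] mono[of "k - 1" k] \<open>B > 0\<close>
    by (auto simp: w_def abs_less_iff not_le less_Suc_eq_le)
  moreover have "0 < (-1) ^ (Suc d - k) * hermite (Suc d) (w k)" if "k \<le> Suc d" for k
  proof -
    consider "k = 0" | "k = Suc d" | i where "k = Suc i" "i < d"
      using \<open>k \<le> Suc d\<close> by (cases k) (auto simp: less_Suc_eq_le le_less)
    thus ?thesis
    proof cases
      case 1
      thus ?thesis using N[OF \<open>B \<ge> N\<close>]
        by (simp add: w_def hermite_minus flip: mult.assoc power_add)
    next
      case 2
      thus ?thesis using N[OF \<open>B \<ge> N\<close>] by (simp add: w_def)
    next
      case (3 i)
      thus ?thesis using sgn[of i] by (simp add: w_def)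
    qed
  qed
  ultimately show ?case by blast
qed

section \<open>Real zeros and Hankel determinants\<close>

text \<open>
  If the determinant were negative, the characteristic polynomial of \<open>- A\<close>, which is monic and has the
  value \<open>det A\<close> at 0, would have a positive root. An eigenvector for this root contradicts
  semidefiniteness.
\<close>

lemma det_nonneg_of_psd:
  fixes A :: "real mat"
  assumes A: "A \<in> carrier_mat n n"
    and psd: "\<And>v. v \<in> carrier_vec n \<Longrightarrow> v \<bullet> (A *\<^sub>v v) \<ge> 0"
  shows "Determinant.det A \<ge> 0"
proof -
  define p where "p = char_poly (- A)"
  have mA: "- A \<in> carrier_mat n n" using A by simp
  have "- char_matrix (- A) 0 = A"
    using A by (intro eq_matI) (auto simp: char_matrix_def)
  hence p0: "poly p 0 = Determinant.det A"
    using char_poly_matrix[OF mA, of 0] by (simp add: p_def)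
  have "lead_coeff p > 0" using degree_monic_char_poly[OF mA] by (simp add: p_def)
  then obtain N where N: "\<And>x. x \<ge> N \<Longrightarrow> poly p x > 0"
    using poly_pinfty_gt_lc[of p] by (fastforce intro: less_le_trans)
  have "\<not> poly p 0 < 0"
  proof
    assume "poly p 0 < 0"
    with poly_IVT_pos[of 0 "max N 1" p] N[of "max N 1"] have "\<exists>x>0. poly p x = 0"
      by force
    then obtain x where x: "x > 0" "poly p x = 0" by blast
    hence "eigenvalue (- A) x" using eigenvalue_root_char_poly[OF mA] by (simp add: p_def)
    then obtain v where "eigenvector (- A) v x" unfolding eigenvalue_def by blast
    moreover have "dim_row A = n" using A by simp
    ultimately have v: "v \<in> carrier_vec n" "v \<noteq> 0\<^sub>v n" "(- A) *\<^sub>v v = x \<cdot>\<^sub>v v"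
      by (simp_all add: eigenvector_def)
    have Av: "A *\<^sub>v v \<in> carrier_vec n" using A v(1) by simp
    have "(- A) *\<^sub>v v = - (A *\<^sub>v v)" using A v(1) by (intro eq_vecI) auto
    hence "v \<bullet> (x \<cdot>\<^sub>v v) = - (v \<bullet> (A *\<^sub>v v))"
      using v(1) Av unfolding v(3)[symmetric] by (simp add: scalar_prod_def sum_negf)
    hence "x * (v \<bullet> v) = - (v \<bullet> (A *\<^sub>v v))" using v(1) by simp
    hence "x * (v \<bullet> v) \<le> 0" using psd[OF v(1)] by simp
    moreover have "v \<bullet> v > 0"
    proof -
      have "\<exists>i<n. vec_index v i \<noteq> 0"
      proof (rule ccontr)
        assume "\<not> (\<exists>i<n. vec_index v i \<noteq> 0)"
        hence "v = 0\<^sub>v n" using v(1) by (intro eq_vecI) auto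
        with v(2) show False by contradiction
      qed
      then obtain i where "i < n" "vec_index v i \<noteq> 0" by blast
      hence "(\<Sum>i<n. vec_index v i * vec_index v i) > 0"
        by (intro sum_pos2[where i = i]) (auto simp: not_sum_squares_lt_zero zero_less_mult_iff)
      thus ?thesis using v(1) by (simp add: scalar_prod_def atLeast0LessThan)
    qed
    ultimately show False using x(1) by (simp add: mult_le_0_iff)
  qed
  thus ?thesis by (simp add: p0)
qed

text \<open>
  The quadratic form of this matrix is \<open>\<Sum>\<beta>. (\<Sum>i. v\<^sub>i \<beta>\<^sup>i)\<^sup>2\<close>.
\<close>

lemma hankel_power_sums_nonneg:
  fixes B :: "real multiset"
  shows "Determinant.det (Matrix.mat k k (\<lambda>(i, j). \<Sum>\<beta>\<in>#B. \<beta> ^ (i + j))) \<ge> 0"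
proof (rule det_nonneg_of_psd[where n = k])
  fix v :: "real Matrix.vec" assume v: "v \<in> carrier_vec k"
  let ?A = "Matrix.mat k k (\<lambda>(i, j). \<Sum>\<beta>\<in>#B. \<beta> ^ (i + j))"
  have pull: "a * ((\<Sum>\<beta>\<in>#B. f \<beta>) * b) = (\<Sum>\<beta>\<in>#B. f \<beta> * (a * b))" for a b :: real and f
    by (induction B) (simp_all add: algebra_simps)
  have "v \<bullet> (?A *\<^sub>v v) = (\<Sum>i<k. \<Sum>j<k. (\<Sum>\<beta>\<in>#B. \<beta> ^ (i + j) * (vec_index v i * vec_index v j)))"
    using v by (simp add: scalar_prod_def sum_distrib_left atLeast0LessThan pull)
  also have "\<dots> = (\<Sum>\<beta>\<in>#B. \<Sum>i<k. \<Sum>j<k. \<beta> ^ (i + j) * (vec_index v i * vec_index v j))"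
    by (induction B) (simp_all add: sum.distrib)
  also have "\<dots> = (\<Sum>\<beta>\<in>#B. (\<Sum>i<k. \<beta> ^ i * vec_index v i) ^ 2)"
    by (simp add: power2_eq_square sum_product power_add mult_ac)
  also have "\<dots> \<ge> 0" by (induction B) auto
  finally show "v \<bullet> (?A *\<^sub>v v) \<ge> 0" .
qed simp

lemma hyperbolic_imp_hankel_nonneg:
  assumes "hyperbolic p"
  shows "hankel_det p k \<in> \<real>\<^sub>\<ge>\<^sub>0"
proof -
  define B where "B = image_mset Re (proots (map_poly complex_of_real p))"
  have re: "complex_of_real (Re \<beta>) = \<beta>" if "\<beta> \<in># proots (map_poly complex_of_real p)" for \<beta>
  proof (cases "p = 0")
    case False
    thus ?thesis using that assms by (auto simp: hyperbolic_def map_poly_eq_0_iff)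
  qed (use that in simp)
  have "root_power_sum p m = of_real (\<Sum>\<beta>\<in>#B. \<beta> ^ m)" for m
  proof -
    have "root_power_sum p m = (\<Sum>\<beta>\<in>#proots (map_poly complex_of_real p). complex_of_real (Re \<beta> ^ m))"
      unfolding root_power_sum_def by (intro arg_cong[where f = sum_mset] image_mset_cong) (simp add: re)
    also have "\<dots> = of_real (\<Sum>\<beta>\<in>#B. \<beta> ^ m)"
      by (simp add: B_def image_mset.compositionality o_def)
    finally show ?thesis .
  qed
  hence "hankel_det p k = Determinant.det (map_mat complex_of_real
           (Matrix.mat k k (\<lambda>(i, j). \<Sum>\<beta>\<in>#B. \<beta> ^ (i + j))))"
    unfolding hankel_det_def by (intro arg_cong[where f = Determinant.det] eq_matI) auto
  also have "\<dots> = of_real (Determinant.det (Matrix.mat k k (\<lambda>(i, j). \<Sum>\<beta>\<in>#B. \<beta> ^ (i + j))))"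
    by (rule of_real_hom.hom_det)
  finally show ?thesis using hankel_power_sums_nonneg[of k B] by simp
qed

lemma hyperbolic_if_all_roots_real:
  assumes "degree p = d" "p \<noteq> 0" "inj_on x {..<d}" "\<And>i. i < d \<Longrightarrow> poly p (x i) = 0"
  shows "hyperbolic p"
proof -
  define q where "q = map_poly complex_of_real p"
  have deg: "degree q = d" and "q \<noteq> 0" using assms by (auto simp: q_def degree_map_poly map_poly_eq_0_iff)
  define Z where "Z = (\<lambda>i. complex_of_real (x i)) ` {..<d}"
  have "finite {z. poly q z = 0}" using \<open>q \<noteq> 0\<close> by (rule poly_roots_finite)
  moreover have "Z \<subseteq> {z. poly q z = 0}"
    using assms(4) by (auto simp: Z_def q_def)
  moreover have "card Z = d"
    unfolding Z_def using assms(3) by (subst card_image) (auto simp: inj_on_def)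
  hence "card {z. poly q z = 0} \<le> card Z"
    using card_poly_roots_bound[OF \<open>q \<noteq> 0\<close>] deg by simp
  ultimately have "Z = {z. poly q z = 0}"
    by (intro card_seteq) auto
  thus ?thesis unfolding hyperbolic_def q_def[symmetric] Z_def by (force simp: set_eq_iff)
qed

section \<open>Dominated convergence of the rescaled integrals\<close>

text \<open>
  Any decay of the form \<open>exp (- L)\<close> with \<open>L\<^sup>3\<close> at least of order \<open>u\<^sup>2\<close> beats every power of \<open>u\<close>: take
  a term of sufficiently high order from the exponential series.
\<close>

lemma power_times_exp_decay:
  fixes \<kappa> :: real
  assumes "\<kappa> > 0"
  shows "\<exists>B\<ge>0. \<forall>u L. 0 \<le> L \<longrightarrow> (1 \<le> \<bar>u\<bar> \<longrightarrow> \<kappa> * u ^ 2 \<le> L ^ 3) \<longrightarrow> \<bar>u\<bar> ^ i * exp (- L) \<le> B * inverse (1 + u ^ 2)"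
proof -
  \<comment> \<open>The term of order \<open>3 p\<close> gives the factor \<open>u ^ (2 * p)\<close>, which exceeds \<open>\<bar>u\<bar> ^ i\<close> by \<open>u ^ 2\<close> at least.\<close>
  define p where "p = Suc i"
  define B :: real where "B = 2 * fact (3 * p) / \<kappa> ^ p + 2"
  have B: "B \<ge> 2 * fact (3 * p) / \<kappa> ^ p" "B \<ge> 2" using assms by (auto simp: B_def)
  have "\<bar>u\<bar> ^ i * exp (- L) \<le> B * inverse (1 + u ^ 2)"
    if L: "0 \<le> L" "1 \<le> \<bar>u\<bar> \<longrightarrow> \<kappa> * u ^ 2 \<le> L ^ 3" for u L :: real
  proof (cases "1 \<le> \<bar>u\<bar>")
    case True
    have u: "u ^ 2 \<ge> 1" using True by (simp add: abs_le_square_iff[of 1 u, simplified])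
    have "(\<kappa> * u ^ 2) ^ p \<le> (L ^ 3) ^ p" using L True assms by (intro power_mono) auto
    also have "\<dots> = L ^ (3 * p)" by (simp add: power_mult)
    also have "\<dots> \<le> fact (3 * p) * exp L"
      using exp_ge_power_over_fact[OF L(1), of "3 * p"] by (simp add: divide_le_eq mult.commute)
    finally have "exp (- L) * (\<kappa> * u ^ 2) ^ p \<le> fact (3 * p)"
      by (simp add: exp_minus field_simps)
    moreover have "\<bar>u\<bar> ^ i \<le> (u ^ 2) ^ i"
      using True by (subst power2_abs[symmetric], subst power_mult[symmetric]) (intro power_increasing, auto)
    ultimately have "\<bar>u\<bar> ^ i * (exp (- L) * (\<kappa> * u ^ 2) ^ p) \<le> (u ^ 2) ^ i * fact (3 * p)"
      using assms by (intro mult_mono) auto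
    moreover have "0 < (\<kappa> * u ^ 2) ^ p"
      by (intro zero_less_power mult_pos_pos assms less_le_trans[OF _ u]) simp
    ultimately have "\<bar>u\<bar> ^ i * exp (- L) \<le> (u ^ 2) ^ i * fact (3 * p) / (\<kappa> * u ^ 2) ^ p"
      by (simp only: pos_le_divide_eq mult.assoc)
    also have "\<dots> = fact (3 * p) / \<kappa> ^ p * (1 / u ^ 2)"
      using assms u by (simp add: p_def power_mult_distrib)
    also have "\<dots> \<le> fact (3 * p) / \<kappa> ^ p * (2 / (1 + u ^ 2))"
      using u assms by (intro mult_left_mono) (auto simp: divide_simps)
    also have "\<dots> = 2 * fact (3 * p) / \<kappa> ^ p * inverse (1 + u ^ 2)" by (simp add: divide_inverse)
    also have "\<dots> \<le> B * inverse (1 + u ^ 2)"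
      by (intro mult_right_mono B) auto
    finally show ?thesis .
  next
    case False
    have "\<bar>u\<bar> ^ i * exp (- L) \<le> 1 * 1" using False L(1) by (intro mult_mono power_le_one) auto
    also have "\<dots> \<le> 2 * inverse (1 + u ^ 2)"
    proof -
      have "u ^ 2 \<le> 1" using False by (simp add: abs_square_le_1)
      hence "1 + u ^ 2 \<le> 2" "1 + u ^ 2 > 0" by (auto intro: add_pos_nonneg)
      thus ?thesis by (simp add: divide_simps)
    qed
    also have "\<dots> \<le> B * inverse (1 + u ^ 2)" by (intro mult_right_mono B) auto
    finally show ?thesis .
  qed
  thus ?thesis using B by (intro exI[of _ B]) auto
qed

lemma norm_1_minus_cis_le: "norm (1 - cis x) \<le> \<bar>x\<bar>"
  using iexp_approx1[of x 0] by (simp add: cis_conv_exp norm_minus_commute)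

lemma scaled_1_minus_cis_tendsto:
  fixes h :: "nat \<Rightarrow> real"
  assumes "\<And>n. h n > 0" "(\<lambda>n. 1 / h n) \<longlonglongrightarrow> 0"
  shows "(\<lambda>n. of_real (h n) * (1 - cis (u / h n))) \<longlonglongrightarrow> - (\<i> * of_real u)"
proof -
  have bound: "norm (of_real (h n) * (1 - cis (u / h n)) - - (\<i> * of_real u)) \<le> u ^ 2 / 2 * (1 / h n)" for n
  proof -
    have "norm (cis (u / h n) - (1 + \<i> * of_real (u / h n))) \<le> (u / h n) ^ 2 / 2"
      using iexp_approx1[of "u / h n" 1] by (simp add: cis_conv_exp eval_nat_numeral)
    hence "h n * norm (cis (u / h n) - (1 + \<i> * of_real (u / h n))) \<le> h n * ((u / h n) ^ 2 / 2)"
      using assms(1)[of n] by (intro mult_left_mono) auto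
    moreover have "of_real (h n) * (1 - cis (u / h n)) - - (\<i> * of_real u) =
        - (of_real (h n) * (cis (u / h n) - (1 + \<i> * of_real (u / h n))))"
      using assms(1)[of n] by (simp add: algebra_simps)
    ultimately show ?thesis
      using assms(1)[of n] by (simp add: norm_mult power2_eq_square)
  qed
  have "(\<lambda>n. u ^ 2 / 2 * (1 / h n)) \<longlonglongrightarrow> 0" by (rule tendsto_mult_right_zero[OF assms(2)])
  hence "(\<lambda>n. of_real (h n) * (1 - cis (u / h n)) - - (\<i> * of_real u)) \<longlonglongrightarrow> 0"
    by (rule Lim_null_comparison[OF always_eventually[OF allI[OF bound]]])
  thus ?thesis by (rule LIM_zero_cancel)
qed

lemma integrable_inverse_1_plus_square': "integrable lborel (\<lambda>x :: real. inverse (1 + x ^ 2))"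
  using integrable_inverse_1_plus_square by (simp add: set_integrable_def)

text \<open>
  Up to the factor \<open>sqrt (2 pi)\<close>, the mean of \<open>(- i sqrt 2 U)\<^sup>i\<close> for a standard normal variable \<open>U\<close>.
\<close>

definition gauss_moment :: "nat \<Rightarrow> complex" where
  "gauss_moment i = (\<integral>u. of_real (exp (- (u ^ 2 / 2))) * (- (\<i> * of_real (sqrt 2 * u))) ^ i \<partial>lborel)"

lemma gauss_moment_eq:
  "gauss_moment i = of_real (sqrt (2 * pi)) * (- (\<i> * of_real (sqrt 2))) ^ i * of_real (\<integral>u. std_normal_density u * u ^ i \<partial>lborel)"
proof -
  have "gauss_moment i = (\<integral>u. (of_real (sqrt (2 * pi)) * (- (\<i> * of_real (sqrt 2))) ^ i) * complex_of_real (std_normal_density u * u ^ i) \<partial>lborel)"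
    unfolding gauss_moment_def
  proof (rule Bochner_Integration.integral_cong[OF refl])
    fix u :: real
    have "- (\<i> * of_real (sqrt 2 * u)) = - (\<i> * of_real (sqrt 2)) * complex_of_real u" by simp
    moreover have "exp (- (u ^ 2 / 2)) = sqrt (2 * pi) * std_normal_density u"
      by (simp add: std_normal_density_def)
    ultimately show "of_real (exp (- (u ^ 2 / 2))) * (- (\<i> * of_real (sqrt 2 * u))) ^ i =
        (of_real (sqrt (2 * pi)) * (- (\<i> * of_real (sqrt 2))) ^ i) * complex_of_real (std_normal_density u * u ^ i)"
      by (simp only: power_mult_distrib of_real_mult of_real_power mult_ac)
  qed
  also have "\<dots> = of_real (sqrt (2 * pi)) * (- (\<i> * of_real (sqrt 2))) ^ i * (\<integral>u. complex_of_real (std_normal_density u * u ^ i) \<partial>lborel)"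
    by (rule integral_mult_right_zero)
  also have "(\<integral>u. complex_of_real (std_normal_density u * u ^ i) \<partial>lborel) = of_real (\<integral>u. std_normal_density u * u ^ i \<partial>lborel)"
    by (rule integral_complex_of_real)
  finally show ?thesis .
qed

lemma gauss_moment_0: "gauss_moment 0 = of_real (sqrt (2 * pi))"
  using integral_std_normal_moment_even[of 0] by (simp add: gauss_moment_eq)

lemma gauss_moment_odd: "gauss_moment (2 * k + 1) = 0"
  by (simp only: gauss_moment_eq integral_std_normal_moment_odd of_real_0 mult_zero_right)

lemma gauss_moment_even: "gauss_moment (2 * k) = of_real (sqrt (2 * pi) * ((-1) ^ k * fact (2 * k) / fact k))"
proof -
  have "(- (\<i> * of_real (sqrt 2))) ^ (2 * k) = complex_of_real ((-2) ^ k)"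
  proof -
    have "(- (\<i> * of_real (sqrt 2))) ^ 2 = complex_of_real (- ((sqrt 2) ^ 2))"
      by (simp only: power2_minus power_mult_distrib of_real_power of_real_minus) simp
    thus ?thesis by (simp add: power_mult)
  qed
  moreover have "(-2 :: real) ^ k = (-1) ^ k * 2 ^ k" by (simp flip: power_mult_distrib)
  ultimately show ?thesis
    unfolding gauss_moment_eq integral_std_normal_moment_even by simp
qed

lemma Re_of_real_mult: "Re (of_real a * z) = a * Re z" by simp

context saddle_points begin

text \<open>
  The exponent \<open>i\<close> belongs to the factor \<open>(1 - cis (u / \<sigma>)) / \<delta>\<close> and \<open>j\<close> to \<open>cis (u / \<sigma>)\<close>. These are the
  terms that arise when \<open>((1 - cis (u / \<sigma>)) / \<delta> + X cis (u / \<sigma>))\<^sup>d\<close> is expanded in powers of \<open>X\<close>.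
  Treating each coefficient separately keeps \<open>X\<close> out of the integrals, so that uniformity in \<open>X\<close>
  costs nothing.
\<close>

definition integrand :: "nat \<Rightarrow> nat \<Rightarrow> nat \<Rightarrow> real \<Rightarrow> complex" where
  "integrand n i j u = indicator {- (pi * \<sigma> n)..pi * \<sigma> n} u *\<^sub>R
     (wave n u * (of_real (sqrt 2 * \<sigma> n) * (1 - cis (u / \<sigma> n))) ^ i * cis (u / \<sigma> n) ^ j)"

definition wave_moment :: "nat \<Rightarrow> nat \<Rightarrow> nat \<Rightarrow> complex" where
  "wave_moment n i j = integral\<^sup>L lborel (integrand n i j)"

lemma measurable_integrand [measurable]: "integrand n i j \<in> borel_measurable borel"
proof -
  have [measurable]: "cis \<in> borel_measurable borel"
    by (intro borel_measurable_continuous_onI continuous_intros)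
  show ?thesis unfolding integrand_def[abs_def] wave_def by measurable
qed

text \<open>
  The factor with exponent \<open>i\<close> is at most \<open>(sqrt 2 |u|)\<^sup>i\<close>, and the wave decays faster than any power.
\<close>

lemma norm_integrand_le:
  "\<exists>B. \<forall>n u. s n \<le> 1 \<longrightarrow> norm (integrand n i j u) \<le> B * inverse (1 + u ^ 2)"
proof -
  obtain \<kappa> where \<kappa>: "\<kappa> > 0" and ge: "\<And>s u. 0 < s \<Longrightarrow> s \<le> 1 \<Longrightarrow> 1 \<le> \<bar>u\<bar> \<Longrightarrow> \<bar>u\<bar> \<le> pi * sqrt (log_moment r 2 s) \<Longrightarrow>
     \<kappa> * u ^ 2 \<le> (\<Sum>m. log_coeff r m * exp (- (real m * s)) * (1 - cos (real m * (u / sqrt (log_moment r 2 s))))) ^ 3"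
    using rescaled_exponent_ge[OF r_pos] by blast
  obtain B where B: "B \<ge> 0" "\<And>u L. 0 \<le> L \<Longrightarrow> (1 \<le> \<bar>u\<bar> \<longrightarrow> \<kappa> * u ^ 2 \<le> L ^ 3) \<Longrightarrow> \<bar>u\<bar> ^ i * exp (- L) \<le> B * inverse (1 + u ^ 2)"
    using power_times_exp_decay[OF \<kappa>, of i] by blast
  have "norm (integrand n i j u) \<le> (sqrt 2 ^ i * B) * inverse (1 + u ^ 2)" if s1: "s n \<le> 1" for n u
  proof (cases "u \<in> {- (pi * \<sigma> n)..pi * \<sigma> n}")
    case True
    hence u: "\<bar>u\<bar> \<le> pi * \<sigma> n" by auto
    define L where "L = - Re (char_exponent r (s n) (u / \<sigma> n))"
    have "L \<ge> 0" unfolding L_def using Re_char_exponent_nonpos[OF s_pos] by simp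
    moreover have "1 \<le> \<bar>u\<bar> \<longrightarrow> \<kappa> * u ^ 2 \<le> L ^ 3"
      unfolding L_def Re_char_exponent[OF s_pos] minus_minus \<sigma>_def
      by (intro impI ge s_pos s1) (use u in \<open>simp_all add: \<sigma>_def\<close>)
    ultimately have *: "\<bar>u\<bar> ^ i * exp (- L) \<le> B * inverse (1 + u ^ 2)" by (rule B(2))
    have "norm (of_real (sqrt 2 * \<sigma> n) * (1 - cis (u / \<sigma> n))) \<le> sqrt 2 * \<bar>u\<bar>"
    proof -
      have "norm (of_real (sqrt 2 * \<sigma> n) * (1 - cis (u / \<sigma> n))) = (sqrt 2 * \<sigma> n) * norm (1 - cis (u / \<sigma> n))"
        using \<sigma>_pos[of n] by (simp add: norm_mult)
      also have "\<dots> \<le> (sqrt 2 * \<sigma> n) * \<bar>u / \<sigma> n\<bar>"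
        using \<sigma>_pos[of n] by (intro mult_left_mono norm_1_minus_cis_le) auto
      also have "\<dots> = sqrt 2 * \<bar>u\<bar>" using \<sigma>_pos[of n] by (simp add: abs_divide)
      finally show ?thesis .
    qed
    hence "norm (of_real (sqrt 2 * \<sigma> n) * (1 - cis (u / \<sigma> n))) ^ i \<le> (sqrt 2 * \<bar>u\<bar>) ^ i"
      by (intro power_mono) auto
    moreover have "norm (integrand n i j u) = exp (- L) * norm (of_real (sqrt 2 * \<sigma> n) * (1 - cis (u / \<sigma> n))) ^ i"
      using True by (simp add: integrand_def wave_def norm_mult norm_power L_def)
    ultimately have "norm (integrand n i j u) \<le> exp (- L) * (sqrt 2 * \<bar>u\<bar>) ^ i"
      by (simp add: mult_left_mono)
    also have "\<dots> = sqrt 2 ^ i * (\<bar>u\<bar> ^ i * exp (- L))" by (simp add: power_mult_distrib)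
    also have "\<dots> \<le> sqrt 2 ^ i * (B * inverse (1 + u ^ 2))" by (intro mult_left_mono *) auto
    finally show ?thesis by (simp add: mult.assoc)
  next
    case False
    thus ?thesis using B(1) by (simp add: integrand_def)
  qed
  thus ?thesis by blast
qed

lemma integrand_tendsto:
  "(\<lambda>n. integrand n i j u) \<longlonglongrightarrow> of_real (exp (- (u ^ 2 / 2))) * (- (\<i> * of_real (sqrt 2 * u))) ^ i"
proof -
  have large: "filterlim \<sigma> at_top sequentially"
    using filterlim_inverse_at_top[OF inverse_\<sigma>_tendsto_0] \<sigma>_pos by simp
  have "eventually (\<lambda>n. \<sigma> n \<ge> \<bar>u\<bar>) sequentially"
    using large by (simp add: filterlim_at_top)
  hence ind: "eventually (\<lambda>n. indicator {- (pi * \<sigma> n)..pi * \<sigma> n} u = (1 :: real)) sequentially"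
  proof eventually_elim
    case (elim n)
    have "\<bar>u\<bar> \<le> 1 * \<sigma> n" using elim by simp
    also have "\<dots> \<le> pi * \<sigma> n" using pi_gt3 \<sigma>_pos[of n] by (intro mult_right_mono) auto
    finally show ?case by (auto simp: indicator_def)
  qed
  have cis: "(\<lambda>n. cis (u / \<sigma> n)) \<longlonglongrightarrow> 1"
  proof -
    have "continuous_on UNIV cis" by (intro continuous_intros)
    hence "isCont cis 0" by (simp add: continuous_on_eq_continuous_at)
    hence "(\<lambda>n. cis (u * (1 / \<sigma> n))) \<longlonglongrightarrow> cis 0"
      by (rule isCont_tendsto_compose[OF _ tendsto_mult_right_zero[OF inverse_\<sigma>_tendsto_0]])
    thus ?thesis by simp
  qed
  have "(\<lambda>n. of_real (\<sigma> n) * (1 - cis (u / \<sigma> n))) \<longlonglongrightarrow> - (\<i> * of_real u)"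
    by (rule scaled_1_minus_cis_tendsto[OF \<sigma>_pos inverse_\<sigma>_tendsto_0])
  hence "(\<lambda>n. of_real (sqrt 2) * (of_real (\<sigma> n) * (1 - cis (u / \<sigma> n)))) \<longlonglongrightarrow> of_real (sqrt 2) * - (\<i> * of_real u)"
    by (intro tendsto_intros)
  hence lin: "(\<lambda>n. of_real (sqrt 2 * \<sigma> n) * (1 - cis (u / \<sigma> n))) \<longlonglongrightarrow> - (\<i> * of_real (sqrt 2 * u))"
    by (simp add: mult_ac)
  have "(\<lambda>n. wave n u * (of_real (sqrt 2 * \<sigma> n) * (1 - cis (u / \<sigma> n))) ^ i * cis (u / \<sigma> n) ^ j) \<longlonglongrightarrow>
      of_real (exp (- (u ^ 2 / 2))) * (- (\<i> * of_real (sqrt 2 * u))) ^ i * 1 ^ j"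
    by (intro tendsto_mult tendsto_power wave_tendsto lin cis)
  moreover have "eventually (\<lambda>n. wave n u * (of_real (sqrt 2 * \<sigma> n) * (1 - cis (u / \<sigma> n))) ^ i * cis (u / \<sigma> n) ^ j = integrand n i j u) sequentially"
    using ind by eventually_elim (simp add: integrand_def)
  ultimately show ?thesis using Lim_transform_eventually by fastforce
qed

text \<open>
  The bound is available once \<open>s n \<le> 1\<close>, so dominated convergence is applied to a tail of the
  sequence.
\<close>

lemma
  shows wave_moment_tendsto: "(\<lambda>n. wave_moment n i j) \<longlonglongrightarrow> gauss_moment i"
    and integrable_integrand: "s n \<le> 1 \<Longrightarrow> integrable lborel (integrand n i j)"
proof -
  obtain B where B: "\<And>n u. s n \<le> 1 \<Longrightarrow> norm (integrand n i j u) \<le> B * inverse (1 + u ^ 2)"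
    using norm_integrand_le[of i j] by blast
  have w: "integrable lborel (\<lambda>u. B * inverse (1 + u ^ 2))"
    by (intro integrable_mult_right integrable_inverse_1_plus_square')
  show "integrable lborel (integrand n i j)" if "s n \<le> 1"
    by (rule Bochner_Integration.integrable_bound[OF w])
       (auto intro!: AE_I2 order_trans[OF B[OF that]])
  obtain n0 where n0: "\<And>n. n \<ge> n0 \<Longrightarrow> s n \<le> 1"
    using s_le_1 by (auto simp: eventually_sequentially)
  have "(\<lambda>n. wave_moment (n + n0) i j) \<longlonglongrightarrow> gauss_moment i"
    unfolding wave_moment_def gauss_moment_def
  proof (rule integral_dominated_convergence[OF _ _ w])
    show "AE u in lborel. norm (integrand (n + n0) i j u) \<le> B * inverse (1 + u ^ 2)" for n
      by (intro AE_I2 B n0) simp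
    show "AE u in lborel. (\<lambda>n. integrand (n + n0) i j u) \<longlonglongrightarrow> of_real (exp (- (u ^ 2 / 2))) * (- (\<i> * of_real (sqrt 2 * u))) ^ i"
      by (intro AE_I2 LIMSEQ_ignore_initial_segment integrand_tendsto)
  qed auto
  thus "(\<lambda>n. wave_moment n i j) \<longlonglongrightarrow> gauss_moment i" by (rule LIMSEQ_offset)
qed

text \<open>
  The factor common to \<open>C(n+j) exp (- j s)\<close> for all \<open>j\<close>, which cancels in the quotient by \<open>C(n)\<close>.
\<close>

definition scale :: "nat \<Rightarrow> real" where
  "scale n = exp (real n * s n) * exp (log_moment r 0 (s n)) / (2 * pi * \<sigma> n)"

lemma scale_pos: "scale n > 0"
  using \<sigma>_pos[of n] by (simp add: scale_def)

lemma coeff_eq_wave_moment: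
  "of_real (fps_nth (H_gf r 1) (n + j) * exp (- (real j * s n))) = of_real (scale n) * wave_moment n 0 j"
proof -
  define c where "c = fps_nth (H_gf r 1) (n + j)"
  have "(LINT \<theta>:{-pi..pi}|lborel. exp (char_exponent r (s n) \<theta>) * cis (real (n + j) * \<theta>)) =
     \<bar>1 / \<sigma> n\<bar> *\<^sub>R (\<integral>u. indicator {-pi..pi} (0 + 1 / \<sigma> n * u) *\<^sub>R
        (exp (char_exponent r (s n) (0 + 1 / \<sigma> n * u)) * cis (real (n + j) * (0 + 1 / \<sigma> n * u))) \<partial>lborel)"
    unfolding set_lebesgue_integral_def
    by (rule lborel_integral_real_affine) (use \<sigma>_pos[of n] in auto)
  also have "\<dots> = of_real (1 / \<sigma> n) * wave_moment n 0 j"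
  proof -
    have "indicator {-pi..pi} (0 + 1 / \<sigma> n * u) *\<^sub>R
        (exp (char_exponent r (s n) (0 + 1 / \<sigma> n * u)) * cis (real (n + j) * (0 + 1 / \<sigma> n * u))) = integrand n 0 j u" for u
    proof -
      have "indicator {-pi..pi} (0 + 1 / \<sigma> n * u) = (indicator {- (pi * \<sigma> n)..pi * \<sigma> n} u :: real)"
        using \<sigma>_pos[of n] by (auto simp: indicator_def field_simps)
      moreover have "cis (real (n + j) * (0 + 1 / \<sigma> n * u)) = cis (real n * (u / \<sigma> n)) * cis (u / \<sigma> n) ^ j"
        by (simp add: Complex.DeMoivre cis_mult field_simps add_divide_distrib)
      ultimately show ?thesis by (simp add: integrand_def wave_def mult.assoc)
    qed
    thus ?thesis using \<sigma>_pos[of n] by (simp add: wave_moment_def scaleR_conv_of_real)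
  qed
  finally have "of_real (c * exp (- (real (n + j) * s n)) * (2 * pi)) =
      of_real (exp (log_moment r 0 (s n))) * (of_real (1 / \<sigma> n) * wave_moment n 0 j)"
    using fourier_coefficient[OF s_pos[of n], of r "n + j"] by (simp only: c_def)
  hence "of_real (exp (real n * s n) / (2 * pi)) * of_real (c * exp (- (real (n + j) * s n)) * (2 * pi)) =
      of_real (scale n) * wave_moment n 0 j"
    by (simp add: scale_def)
  moreover have "exp (real n * s n) / (2 * pi) * (c * exp (- (real (n + j) * s n)) * (2 * pi)) = c * exp (- (real j * s n))"
  proof -
    have "exp (real n * s n) * exp (- (real (n + j) * s n)) = exp (- (real j * s n))"
      unfolding exp_add[symmetric] by (simp add: algebra_simps)
    moreover have "exp (real n * s n) / (2 * pi) * (c * exp (- (real (n + j) * s n)) * (2 * pi)) =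
        c * (exp (real n * s n) * exp (- (real (n + j) * s n)))"
      by simp
    ultimately show ?thesis by (simp only:)
  qed
  ultimately show ?thesis unfolding c_def of_real_mult[symmetric] by metis
qed

section \<open>Normalised Jensen polynomials\<close>

text \<open>
  The value for which \<open>(1 - cis (u / \<sigma>)) / \<delta>\<close> tends to \<open>- i sqrt 2 u\<close>, whose square has Gaussian mean
  \<open>- 2\<close> as the normalisation of the Hermite polynomials demands.
\<close>

definition \<delta> :: "nat \<Rightarrow> real" where "\<delta> n = 1 / (sqrt 2 * \<sigma> n)"

lemma \<delta>_pos: "\<delta> n > 0" using \<sigma>_pos[of n] by (simp add: \<delta>_def)

lemma \<delta>_tendsto_0: "\<delta> \<longlonglongrightarrow> 0"
  using tendsto_mult_right_zero[OF inverse_\<sigma>_tendsto_0, of "1 / sqrt 2"] by (simp add: \<delta>_def[abs_def])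

text \<open>
  Under the integral, with \<open>w = cis (u / \<sigma>)\<close>, both sides are expansions of
  \<open>((1 + (\<delta> X - 1) w) / \<delta>)\<^sup>d = ((1 - w) / \<delta> + X w)\<^sup>d\<close>. The powers of \<open>1 / \<delta>\<close> on the left, which
  diverge, have been absorbed on the right into integrals that converge.
\<close>

lemma wave_moment_binomial:
  assumes "s n \<le> 1"
  shows "(\<Sum>j\<le>d. of_real (of_nat (d choose j) * (\<delta> n * X - 1) ^ j / \<delta> n ^ d) * wave_moment n 0 j) =
         (\<Sum>j\<le>d. of_real (of_nat (d choose j) * X ^ j) * wave_moment n (d - j) j)"
proof -
  have pointwise: "(\<Sum>j\<le>d. of_real (of_nat (d choose j) * (\<delta> n * X - 1) ^ j / \<delta> n ^ d) * integrand n 0 j u) =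
      (\<Sum>j\<le>d. of_real (of_nat (d choose j) * X ^ j) * integrand n (d - j) j u)" for u
  proof -
    define w where "w = cis (u / \<sigma> n)"
    define D where "D = complex_of_real (\<delta> n)"
    define x where "x = complex_of_real X"
    define a where "a = (1 - w) / D"
    define I where "I = indicator {- (pi * \<sigma> n)..pi * \<sigma> n} u *\<^sub>R wave n u"
    have "D \<noteq> 0" using \<delta>_pos[of n] by (simp add: D_def)
    have a: "of_real (sqrt 2 * \<sigma> n) * (1 - cis (u / \<sigma> n)) = a"
      by (simp add: a_def D_def \<delta>_def w_def)
    have integrand: "integrand n i j u = I * (a ^ i * w ^ j)" for i j
      unfolding integrand_def a by (simp add: I_def w_def mult.assoc)
    have "(\<Sum>j\<le>d. of_nat (d choose j) * ((D * x - 1) * w) ^ j * 1 ^ (d - j)) / D ^ d = ((D * x - 1) * w + 1) ^ d / D ^ d"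
      by (subst binomial_ring) simp
    also have "\<dots> = (x * w + a) ^ d"
    proof -
      have "(D * x - 1) * w + 1 = D * (x * w + a)"
      proof -
        have "D * a = 1 - w" using \<open>D \<noteq> 0\<close> by (simp add: a_def)
        thus ?thesis by (simp add: distrib_left) (simp add: algebra_simps)
      qed
      thus ?thesis using \<open>D \<noteq> 0\<close> by (simp add: power_mult_distrib)
    qed
    also have "\<dots> = (\<Sum>j\<le>d. of_nat (d choose j) * (x * w) ^ j * a ^ (d - j))" by (rule binomial_ring)
    finally have "I * ((\<Sum>j\<le>d. of_nat (d choose j) * ((D * x - 1) * w) ^ j * 1 ^ (d - j)) / D ^ d) =
        I * (\<Sum>j\<le>d. of_nat (d choose j) * (x * w) ^ j * a ^ (d - j))" by simp
    thus ?thesis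
      unfolding integrand sum_distrib_left sum_divide_distrib
      by (simp add: D_def x_def power_mult_distrib mult_ac)
  qed
  have "(\<Sum>j\<le>d. of_real (of_nat (d choose j) * (\<delta> n * X - 1) ^ j / \<delta> n ^ d) * wave_moment n 0 j) =
      (\<integral>u. (\<Sum>j\<le>d. of_real (of_nat (d choose j) * (\<delta> n * X - 1) ^ j / \<delta> n ^ d) * integrand n 0 j u) \<partial>lborel)"
    unfolding wave_moment_def
    by (subst Bochner_Integration.integral_sum) (auto intro!: integrable_mult_right integrable_integrand assms)
  also have "\<dots> = (\<Sum>j\<le>d. of_real (of_nat (d choose j) * X ^ j) * wave_moment n (d - j) j)"
    unfolding wave_moment_def pointwise
    by (subst Bochner_Integration.integral_sum) (auto intro!: integrable_mult_right integrable_integrand assms)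
  finally show ?thesis .
qed

lemma eventually_wave_moment_nonzero: "eventually (\<lambda>n. wave_moment n 0 0 \<noteq> 0) sequentially"
  using tendsto_imp_eventually_ne[OF wave_moment_tendsto[of 0 0]] by (simp add: gauss_moment_0)

lemma eventually_coeff_nonzero: "eventually (\<lambda>n. fps_nth (H_gf r 1) n \<noteq> 0) sequentially"
  using eventually_wave_moment_nonzero
proof eventually_elim
  case (elim n)
  thus ?case using coeff_eq_wave_moment[of n 0] scale_pos[of n] by auto
qed

lemma normalized_jensen_eq:
  fixes \<alpha> :: "nat \<Rightarrow> real"
  assumes \<alpha>: "\<And>n. \<alpha> n = fps_nth (H_gf r 1) n" and "s n \<le> 1" "wave_moment n 0 0 \<noteq> 0"
  shows "\<delta> n powi (- int d) / \<alpha> n * poly (jensen_poly \<alpha> d n) ((\<delta> n * X - 1) / exp (s n)) =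
    (\<Sum>j\<le>d. (of_nat (d choose j) * Re (wave_moment n (d - j) j / wave_moment n 0 0)) * X ^ j)"
proof -
  let ?L = "\<delta> n powi (- int d) / \<alpha> n * poly (jensen_poly \<alpha> d n) ((\<delta> n * X - 1) / exp (s n))"
  have \<alpha>n: "complex_of_real (\<alpha> n) = of_real (scale n) * wave_moment n 0 0"
    using coeff_eq_wave_moment[of n 0] by (simp add: \<alpha>)
  have "?L = (\<Sum>j\<le>d. (of_nat (d choose j) * (\<delta> n * X - 1) ^ j / \<delta> n ^ d) * (\<alpha> (n + j) * exp (- (real j * s n)))) / \<alpha> n"
    by (simp add: jensen_poly_def poly_sum poly_monom power_int_minus power_divide sum_distrib_left sum_divide_distrib
        exp_minus exp_of_nat_mult divide_inverse power_mult_distrib power_inverse mult_ac)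
  hence "complex_of_real ?L = of_real (\<Sum>j\<le>d. (of_nat (d choose j) * (\<delta> n * X - 1) ^ j / \<delta> n ^ d) *
      (\<alpha> (n + j) * exp (- (real j * s n)))) / of_real (\<alpha> n)"
    by (simp only: of_real_divide)
  also have "\<dots> = (\<Sum>j\<le>d. of_real (of_nat (d choose j) * (\<delta> n * X - 1) ^ j / \<delta> n ^ d) *
      (of_real (scale n) * wave_moment n 0 j)) / (of_real (scale n) * wave_moment n 0 0)"
    unfolding \<alpha>n of_real_sum
  proof (intro arg_cong2[where f = "(/)"] sum.cong refl)
    fix j
    show "complex_of_real ((of_nat (d choose j) * (\<delta> n * X - 1) ^ j / \<delta> n ^ d) * (\<alpha> (n + j) * exp (- (real j * s n)))) =
        of_real (of_nat (d choose j) * (\<delta> n * X - 1) ^ j / \<delta> n ^ d) * (of_real (scale n) * wave_moment n 0 j)"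
      by (subst of_real_mult) (simp only: \<alpha> coeff_eq_wave_moment)
  qed
  also have "\<dots> = (\<Sum>j\<le>d. of_real (of_nat (d choose j) * (\<delta> n * X - 1) ^ j / \<delta> n ^ d) * wave_moment n 0 j) / wave_moment n 0 0"
  proof -
    have "(\<Sum>j\<le>d. of_real (of_nat (d choose j) * (\<delta> n * X - 1) ^ j / \<delta> n ^ d) * (of_real (scale n) * wave_moment n 0 j)) =
        of_real (scale n) * (\<Sum>j\<le>d. of_real (of_nat (d choose j) * (\<delta> n * X - 1) ^ j / \<delta> n ^ d) * wave_moment n 0 j)"
      unfolding sum_distrib_left by (intro sum.cong refl) (rule mult.left_commute)
    moreover have "complex_of_real (scale n) \<noteq> 0" using scale_pos[of n] by simp
    ultimately show ?thesis by (simp only: mult_divide_mult_cancel_left_if if_False)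
  qed
  also have "\<dots> = (\<Sum>j\<le>d. of_real (of_nat (d choose j) * X ^ j) * (wave_moment n (d - j) j / wave_moment n 0 0))"
    unfolding wave_moment_binomial[OF assms(2)] by (simp add: sum_divide_distrib)
  finally have "Re (complex_of_real ?L) = Re (\<Sum>j\<le>d. of_real (of_nat (d choose j) * X ^ j) * (wave_moment n (d - j) j / wave_moment n 0 0))"
    by (rule arg_cong)
  also have "\<dots> = (\<Sum>j\<le>d. of_nat (d choose j) * X ^ j * Re (wave_moment n (d - j) j / wave_moment n 0 0))"
    unfolding Re_sum by (intro sum.cong refl) (rule Re_of_real_mult)
  finally show ?thesis by (simp only: Re_complex_of_real mult_ac)
qed


lemma normalized_coeffs_tendsto:
  "(\<lambda>n. Re (wave_moment n i j / wave_moment n 0 0)) \<longlonglongrightarrow> Re (gauss_moment i / gauss_moment 0)"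
  by (intro tendsto_Re tendsto_divide wave_moment_tendsto) (simp add: gauss_moment_0)

end

lemma hermite_eq_gauss_moments:
  "(\<Sum>j\<le>d. (of_nat (d choose j) * Re (gauss_moment (d - j) / gauss_moment 0)) * X ^ j) = hermite d X"
proof -
  have "Re (gauss_moment (2 * k) / gauss_moment 0) = (-1) ^ k * fact (2 * k) / fact k" for k
  proof -
    have "gauss_moment (2 * k) / gauss_moment 0 = of_real ((-1) ^ k * fact (2 * k) / fact k)"
      unfolding gauss_moment_0 gauss_moment_even of_real_divide[symmetric]
      by (rule arg_cong[where f = of_real]) simp
    thus ?thesis by (simp only: Re_complex_of_real)
  qed
  moreover have "Re (gauss_moment (2 * k + 1) / gauss_moment 0) = 0" for k
    by (simp only: gauss_moment_odd div_0 zero_complex.sel)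
  ultimately have "(\<Sum>j\<le>d. of_nat (d choose j) * X ^ j * Re (gauss_moment (d - j) / gauss_moment 0)) = hermite d X"
    by (rule hermite_binomial_sum)
  thus ?thesis by (simp add: mult_ac)
qed

lemma uniform_limit_polynomials:
  fixes a :: "nat \<Rightarrow> nat \<Rightarrow> real"
  assumes "\<And>j. j \<le> d \<Longrightarrow> (\<lambda>n. a n j) \<longlonglongrightarrow> b j" "compact K"
  shows "uniform_limit K (\<lambda>n x. \<Sum>j\<le>d. a n j * x ^ j) (\<lambda>x. \<Sum>j\<le>d. b j * x ^ j) sequentially"
proof (rule uniform_limitI)
  fix e :: real assume "e > 0"
  obtain B where B: "\<And>x. x \<in> K \<Longrightarrow> norm x \<le> B" "B \<ge> 1"
    using compact_imp_bounded[OF assms(2)] bounded_pos[of K] by (metis le_max_iff_disj max.cobounded2 order_refl)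
  have "(\<lambda>n. \<Sum>j\<le>d. \<bar>a n j - b j\<bar> * B ^ j) \<longlonglongrightarrow> (\<Sum>j\<le>d. \<bar>b j - b j\<bar> * B ^ j)"
    by (intro tendsto_intros assms) auto
  hence "eventually (\<lambda>n. (\<Sum>j\<le>d. \<bar>a n j - b j\<bar> * B ^ j) < e) sequentially"
    using \<open>e > 0\<close> by (intro order_tendstoD(2)) auto
  thus "eventually (\<lambda>n. \<forall>x\<in>K. dist (\<Sum>j\<le>d. a n j * x ^ j) (\<Sum>j\<le>d. b j * x ^ j) < e) sequentially"
  proof eventually_elim
    case (elim n)
    show ?case
    proof
      fix x assume "x \<in> K"
      have "dist (\<Sum>j\<le>d. a n j * x ^ j) (\<Sum>j\<le>d. b j * x ^ j) = \<bar>\<Sum>j\<le>d. (a n j - b j) * x ^ j\<bar>"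
        by (simp add: dist_real_def sum_subtractf left_diff_distrib)
      also have "\<dots> \<le> (\<Sum>j\<le>d. \<bar>a n j - b j\<bar> * B ^ j)"
        using B(1)[OF \<open>x \<in> K\<close>]
        by (intro order_trans[OF sum_abs] sum_mono) (auto simp: abs_mult power_abs intro!: mult_left_mono power_mono)
      also have "\<dots> < e" by (rule elim)
      finally show "dist (\<Sum>j\<le>d. a n j * x ^ j) (\<Sum>j\<le>d. b j * x ^ j) < e" .
    qed
  qed
qed

lemma degree_jensen_poly:
  assumes "\<alpha> (n + d) \<noteq> 0" shows "degree (jensen_poly \<alpha> d n) = d"
proof (rule antisym)
  have coeff: "coeff (jensen_poly \<alpha> d n) k = (if k \<le> d then of_nat (d choose k) * \<alpha> (n + k) else 0)" for k
    unfolding jensen_poly_def coeff_sum coeff_monom by simp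
  show "degree (jensen_poly \<alpha> d n) \<le> d" by (rule degree_le) (simp add: coeff)
  show "d \<le> degree (jensen_poly \<alpha> d n)" by (rule le_degree) (simp add: coeff assms)
qed

text \<open>
  The sign pattern of the Hermite polynomial at finitely many points is inherited by the normalised polynomials
  of large index. The affine change of variable is injective, so it carries their \<open>d\<close> distinct zeros to \<open>d\<close>
  distinct real zeros of the polynomials themselves.
\<close>

lemma hermite_limit_imp_eventually_hyperbolic:
  fixes p :: "nat \<Rightarrow> real poly" and c \<delta> A :: "nat \<Rightarrow> real"
  assumes lim: "\<And>X. (\<lambda>n. c n * poly (p n) ((\<delta> n * X - 1) / exp (A n))) \<longlonglongrightarrow> hermite d X"
    and \<delta>: "\<And>n. \<delta> n > 0" and deg: "eventually (\<lambda>n. degree (p n) = d) sequentially" and d: "d \<ge> 1"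
  shows "eventually (\<lambda>n. hyperbolic (p n)) sequentially"
proof -
  obtain z where z: "\<And>k. k < d \<Longrightarrow> z k < z (Suc k)" "\<And>k. k \<le> d \<Longrightarrow> 0 < (-1) ^ (d - k) * hermite d (z k)"
    using hermite_alternates[of d] by blast
  define g where "g n X = c n * poly (p n) ((\<delta> n * X - 1) / exp (A n))" for n X
  have "eventually (\<lambda>n. 0 < (-1) ^ (d - k) * g n (z k)) sequentially" if "k \<in> {..d}" for k
    unfolding g_def using that z(2)[of k] tendsto_mult[OF tendsto_const lim[of "z k"], of "(-1) ^ (d - k)"]
    by (intro order_tendstoD(1)) auto
  hence "eventually (\<lambda>n. \<forall>k\<in>{..d}. 0 < (-1) ^ (d - k) * g n (z k)) sequentially"
    by (intro eventually_ball_finite) auto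
  with deg show ?thesis
  proof eventually_elim
    case (elim n)
    have "continuous_on UNIV (g n)" unfolding g_def[abs_def] by (intro continuous_intros) auto
    hence "\<exists>x. \<forall>i<d. g n (x i) = 0 \<and> z i < x i \<and> x i < z (Suc i)"
      using elim(2) by (intro alternating_imp_zeros z(1)) auto
    then obtain x
      where x: "\<And>i. i < d \<Longrightarrow> g n (x i) = 0" "\<And>i. i < d \<Longrightarrow> z i < x i" "\<And>i. i < d \<Longrightarrow> x i < z (Suc i)"
      by blast
    have "c n \<noteq> 0" using elim(2) by (auto simp: g_def)
    have step: "x k < x (Suc k)" if "Suc k < d" for k
      using x(3)[of k] x(2)[of "Suc k"] that by simp
    have mono: "x i < x j" if "i < j" "j < d" for i j
      using strictly_increasing_upto[of d x i j] step that by blast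
    define y where "y i = (\<delta> n * x i - 1) / exp (A n)" for i
    have "inj_on y {..<d}"
    proof (rule inj_onI)
      fix i j assume "i \<in> {..<d}" "j \<in> {..<d}" "y i = y j"
      hence "x i = x j" using \<delta>[of n] by (simp add: y_def)
      thus "i = j" using mono[of i j] mono[of j i] \<open>i \<in> {..<d}\<close> \<open>j \<in> {..<d}\<close>
        by (cases i j rule: linorder_cases) auto
    qed
    moreover have "poly (p n) (y i) = 0" if "i < d" for i
      using x(1)[OF that] \<open>c n \<noteq> 0\<close> by (simp add: g_def y_def)
    ultimately show ?case
      using elim(1) d by (intro hyperbolic_if_all_roots_real[where x = y]) auto
  qed
qed

section \<open>Hyperbolicity, Hermite limit and Turan inequalities\<close>

theorem theorem1p3:
  fixes r t :: nat
  assumes "r > 0" and "t > 0"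
  shows
    "(\<forall>d\<ge>1.
        finite {n. \<not> hyperbolic (jensen_poly (C_seq r t) d n)} \<and>
        (\<exists>A \<delta> :: nat \<Rightarrow> real.
           (\<forall>n. A n > 0) \<and> (\<forall>n. \<delta> n > 0) \<and> \<delta> \<longlonglongrightarrow> 0 \<and>
           (\<forall>K. compact K \<longrightarrow>
              uniform_limit K
                (\<lambda>n X. \<delta> n powi (- int d) / C_seq r t n *
                        poly (jensen_poly (C_seq r t) d n) ((\<delta> n * X - 1) / exp (A n)))
                (\<lambda>X. hermite d X) sequentially)))
     \<and> (\<forall>d\<ge>1. \<forall>\<^sub>F n in sequentially. turan_inequalities (C_seq r t) d n)"
proof -
  \<comment> \<open>There is no saddle point for \<open>n = 0\<close>; any positive value will do there.\<close>
  define s where "s n = (if n = 0 then 1 else SOME s. s > 0 \<and> log_moment r 1 s = real n)" for n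
  have s: "s n > 0 \<and> (n > 0 \<longrightarrow> log_moment r 1 (s n) = real n)" for n
  proof (cases "n = 0")
    case False
    hence "\<exists>s. s > 0 \<and> log_moment r 1 s = real n" using saddle_exists[OF assms(1), of n] by auto
    from someI_ex[OF this] False show ?thesis by (simp add: s_def)
  qed (simp add: s_def)
  interpret saddle_points r s
    by unfold_locales (use s assms in auto)
  define \<alpha> where "\<alpha> = C_seq r t"
  have \<alpha>: "\<alpha> n = fps_nth (H_gf r 1) n" for n
    unfolding \<alpha>_def by (rule C_seq_eq_H_gf_1[OF assms(2)])
  have limit: "uniform_limit K (\<lambda>n X. \<delta> n powi (- int d) / \<alpha> n * poly (jensen_poly \<alpha> d n) ((\<delta> n * X - 1) / exp (s n)))
      (\<lambda>X. hermite d X) sequentially" if "compact K" for K d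
  proof -
    have "uniform_limit K
        (\<lambda>n X. \<Sum>j\<le>d. (of_nat (d choose j) * Re (wave_moment n (d - j) j / wave_moment n 0 0)) * X ^ j)
        (\<lambda>X. \<Sum>j\<le>d. (of_nat (d choose j) * Re (gauss_moment (d - j) / gauss_moment 0)) * X ^ j) sequentially"
      by (intro uniform_limit_polynomials tendsto_mult tendsto_const normalized_coeffs_tendsto that)
    moreover have "eventually (\<lambda>n. \<forall>X\<in>K.
        \<delta> n powi (- int d) / \<alpha> n * poly (jensen_poly \<alpha> d n) ((\<delta> n * X - 1) / exp (s n)) =
        (\<Sum>j\<le>d. (of_nat (d choose j) * Re (wave_moment n (d - j) j / wave_moment n 0 0)) * X ^ j)) sequentially"
      using s_le_1 eventually_wave_moment_nonzero
      by eventually_elim (use normalized_jensen_eq[OF \<alpha>] in blast)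
    ultimately show ?thesis
      by (subst uniform_limit_cong[where g = "\<lambda>n X. \<Sum>j\<le>d. (of_nat (d choose j) * Re (wave_moment n (d - j) j / wave_moment n 0 0)) * X ^ j"
          and i = "\<lambda>X. \<Sum>j\<le>d. (of_nat (d choose j) * Re (gauss_moment (d - j) / gauss_moment 0)) * X ^ j"])
         (auto simp: hermite_eq_gauss_moments)
  qed
  have deg: "eventually (\<lambda>n. degree (jensen_poly \<alpha> d n) = d) sequentially" for d
  proof -
    have "eventually (\<lambda>n. fps_nth (H_gf r 1) (n + d) \<noteq> 0) sequentially"
      by (rule sequentially_offset[OF eventually_coeff_nonzero])
    thus ?thesis by eventually_elim (simp add: degree_jensen_poly \<alpha>)
  qed
  have hyp: "eventually (\<lambda>n. hyperbolic (jensen_poly \<alpha> d n)) sequentially" if "d \<ge> 1" for d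
  proof (rule hermite_limit_imp_eventually_hyperbolic[where \<delta> = \<delta> and A = s])
    show "(\<lambda>n. \<delta> n powi (- int d) / \<alpha> n * poly (jensen_poly \<alpha> d n) ((\<delta> n * X - 1) / exp (s n))) \<longlonglongrightarrow> hermite d X" for X
      using limit[of "{X}" d] by simp
  qed (use deg that \<delta>_pos in auto)
  show ?thesis
    unfolding \<alpha>_def[symmetric]
  proof (intro conjI allI impI)
    fix d :: nat assume d: "d \<ge> 1"
    show "finite {n. \<not> hyperbolic (jensen_poly \<alpha> d n)}"
      using hyp[OF d] by (simp add: cofinite_eq_sequentially[symmetric] eventually_cofinite)
    show "\<exists>A \<delta> :: nat \<Rightarrow> real. (\<forall>n. A n > 0) \<and> (\<forall>n. \<delta> n > 0) \<and> \<delta> \<longlonglongrightarrow> 0 \<and>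
           (\<forall>K. compact K \<longrightarrow> uniform_limit K
                (\<lambda>n X. \<delta> n powi (- int d) / \<alpha> n * poly (jensen_poly \<alpha> d n) ((\<delta> n * X - 1) / exp (A n)))
                (\<lambda>X. hermite d X) sequentially)"
      using s_pos \<delta>_pos \<delta>_tendsto_0 limit by blast
    show "\<forall>\<^sub>F n in sequentially. turan_inequalities \<alpha> d n"
      using hyp[OF d] deg[of d]
      by eventually_elim (simp add: turan_inequalities_def hyperbolic_imp_hankel_nonneg)
  qed
qed

end
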